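(* Let $p$ be an odd prime and let $C_f\colon y^p-y=f(x)$ be an Artin–Schreier curve over $\overline{\mathbb{F}}_p$ such that $f$ has $r+1$ distinct poles on $\mathbb{P}^1(\overline{\mathbb{F}}_p)$ of respective orders $d_1\ge d_2\ge\cdots\ge d_{r+1}$. Then $C_f$ is isomorphic to an Artin–Schreier curve $C_g\colon y^p-y=g(x)$ where $g(x)\in\overline{\mathbb{F}}_p(x)$ takes one of the following forms: (1) If $r=0$: $g(x)=x^{d_1}+Q(x)$, where $Q(x)\in\overline{\mathbb{F}}_p[x]$ is a multiple of $x^2$ and no monomial appearing in $Q(x)$ has an exponent divisible by $p$. (2) If $r=1$: $g(x)=F(x)+G(1/x)$, where $F,G\in\overline{\mathbb{F}}_p[x]$, $F$ is monic, $\deg F=d_1$, $\deg G=d_2$, and no monomial appearing in $F(x)$ or $G(x)$ has an exponent divisible by $p$. (3) If $r\ge2$: $g(x)=F(x)+G\!\left(\frac1x\right)+H\!\left(\frac1{x-1}\right)+S(x)$, where $F,G,H\in\overline{\mathbb{F}}_p[x]$, $\deg F=d_1$, $\deg G=d_2$, $\deg H=d_3$, and either $S(x)=0$ or \[S(x)=\sum_{i=4}^{r+1}\frac{g_i(x-\lambda_i)}{(x-\lambda_i)^{d_i}}\] with $\lambda_i\in\overline{\mathbb{F}}_p\setminus\{0,1\}$, $g_i\in\overline{\mathbb{F}}_p[x]$ nonzero with $\deg g_i<d_i$; and no monomial appearing in $F(x)$, $G(x)$, $H(x)$, or any of the polynomials $x^{d_i}g_i(x^{-1})$ ($4\le i\le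 r+1$) has an exponent divisible by $p$.
   Context: An Artin–Schreier curve over $\overline{\mathbb{F}}_p$ is a curve with affine model $y^p-y=f(x)$, $f\in\overline{\mathbb{F}}_p(x)$ not of the form $z^p-z$ with $z\in\overline{\mathbb{F}}_p(x)$. Poles of $f$ are taken on $\mathbb{P}^1$, including possibly the point at infinity. The paper works under the standing convention that no pole order $d_i$ is divisible by $p$. Isomorphism means $\overline{\mathbb{F}}_p$-isomorphism of curves. A curve $C_g$ of the form in the conclusion is said to be in standard form. *)

theory Defs
  imports
    "HOL-Algebra.Algebraic_Closure_Type"
    "HOL-Analysis.Abstract_Topology"
    "Berlekamp_Zassenhaus.Finite_Field"
begin

text \<open>
  The field \<open>k(x)\<close> is \<^typ>\<open>'k poly fract\<close>. The type \<^typ>\<open>'p mod_ring alg_closure\<close> is the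
  algebraic closure of the field with \<open>p = CARD('p)\<close> elements.
\<close>

instance alg_closure :: (field) field_gcd ..

subsection \<open>Rational functions and their poles on the projective line\<close>

definition rat_const :: "'k::field \<Rightarrow> 'k poly fract" where
  "rat_const c = to_fract [:c:]"

definition rat_X :: "'k::field poly fract" where
  "rat_X = to_fract [:0, 1:]"

definition rat_subst :: "'k::field poly \<Rightarrow> 'k poly fract \<Rightarrow> 'k poly fract" where
  "rat_subst F t = poly (map_poly rat_const F) t"

datatype 'k proj_line = Affine 'k | Infinity

text \<open>
  \<^const>\<open>quot_of_fract\<close> returns coprime numerator and denominator, so at an affine point the pole
  order is the multiplicity of the root of the denominator. At infinity the subtraction on
  \<^typ>\<open>nat\<close> truncates to \<open>0\<close> if there is no pole.
\<close>
fun pole_order :: "'k::field_gcd poly fract \<Rightarrow> 'k proj_line \<Rightarrow> nat" where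
  "pole_order f (Affine a) = Polynomial.order a (snd (quot_of_fract f))"
| "pole_order f Infinity =
     Polynomial.degree (fst (quot_of_fract f)) - Polynomial.degree (snd (quot_of_fract f))"

definition poles :: "'k::field_gcd poly fract \<Rightarrow> 'k proj_line set" where
  "poles f = {P. pole_order f P > 0}"

subsection \<open>The nonsingular projective curve with a given function field\<close>

text \<open>
  A curve is given by its points with the Zariski topology and, for every open set \<open>U\<close>, the
  \<open>k\<close>-valued functions that are regular on \<open>U\<close>. Functions are total in HOL; values outside \<open>U\<close>
  play no role.
\<close>
record ('pt, 'k) curve =
  zariski :: "'pt topology"
  regular :: "'pt set \<Rightarrow> ('pt \<Rightarrow> 'k) set"

text \<open>
  Isomorphism of varieties over \<open>k\<close>: a homeomorphism that preserves regular functions in both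
  directions.
\<close>
definition curve_isomorphic :: "('a, 'k) curve \<Rightarrow> ('b, 'k) curve \<Rightarrow> bool" where
  "curve_isomorphic C D \<longleftrightarrow>
     (\<exists>\<phi>. homeomorphic_map (zariski C) (zariski D) \<phi> \<and>
       (\<forall>V h. openin (zariski D) V \<longrightarrow>
          (h \<in> regular D V \<longleftrightarrow>
           h \<circ> \<phi> \<in> regular C {P \<in> topspace (zariski C). \<phi> P \<in> V})))"

text \<open>
  The next definitions construct, for a function field \<open>L\<close> of one variable over an algebraically
  closed field \<open>k\<close> embedded by \<open>\<iota>\<close>, the abstract nonsingular curve of \<open>L\<close> (Hartshorne, I.6). Its
  points are the places of \<open>L\<close>, that is, the valuation rings of \<open>L\<close> that contain \<open>k\<close> and differ
  from \<open>L\<close> (Stichtenoth, Definition 1.1.4; in a function field these are all discrete).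
\<close>
definition places :: "('l, 'm) ring_scheme \<Rightarrow> ('k \<Rightarrow> 'l) \<Rightarrow> 'l set set" where
  "places L \<iota> = {R. subring R L \<and> range \<iota> \<subseteq> R \<and> R \<noteq> carrier L \<and>
     (\<forall>z \<in> carrier L - {\<zero>\<^bsub>L\<^esub>}. z \<in> R \<or> inv\<^bsub>L\<^esub> z \<in> R)}"

definition place_ideal :: "('l, 'm) ring_scheme \<Rightarrow> 'l set \<Rightarrow> 'l set" where
  "place_ideal L R = {z \<in> R. z = \<zero>\<^bsub>L\<^esub> \<or> inv\<^bsub>L\<^esub> z \<notin> R}"

text \<open>The closed sets are the finite sets and the whole curve.\<close>
definition zariski_places :: "('l, 'm) ring_scheme \<Rightarrow> ('k \<Rightarrow> 'l) \<Rightarrow> 'l set topology" where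
  "zariski_places L \<iota> =
     topology (\<lambda>U. U \<subseteq> places L \<iota> \<and> (U = {} \<or> finite (places L \<iota> - U)))"

lemma istopology_cofinite:
  "istopology (\<lambda>U. U \<subseteq> S \<and> (U = {} \<or> finite (S - U)))"
  unfolding istopology_def
proof (rule conjI; intro allI impI)
  fix A B :: "'a set"
  assume "A \<subseteq> S \<and> (A = {} \<or> finite (S - A))" "B \<subseteq> S \<and> (B = {} \<or> finite (S - B))"
  then show "A \<inter> B \<subseteq> S \<and> (A \<inter> B = {} \<or> finite (S - A \<inter> B))"
    by (auto simp: Diff_Int)
next
  fix K :: "'a set set"
  assume K: "\<forall>A\<in>K. A \<subseteq> S \<and> (A = {} \<or> finite (S - A))"
  have "finite (S - \<Union>K)" if "A \<in> K" "A \<noteq> {}" for A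
    using K that by (intro finite_subset[of "S - \<Union>K" "S - A"]) auto
  then show "\<Union>K \<subseteq> S \<and> (\<Union>K = {} \<or> finite (S - \<Union>K))"
    using K by blast
qed

lemma openin_zariski_places:
  "openin (zariski_places L \<iota>) U \<longleftrightarrow>
     U \<subseteq> places L \<iota> \<and> (U = {} \<or> finite (places L \<iota> - U))"
  by (simp add: zariski_places_def topology_inverse'[OF istopology_cofinite])

text \<open>
  A function \<open>h\<close> is regular on \<open>U\<close> if some element of \<open>L\<close> lies in every valuation ring \<open>R \<in> U\<close>
  and has residue class \<open>h R\<close> there. The residue field is \<open>k\<close>, because \<open>k\<close> is algebraically closed.
\<close>
definition regular_places ::
  "('l, 'm) ring_scheme \<Rightarrow> ('k \<Rightarrow> 'l) \<Rightarrow> 'l set set \<Rightarrow> ('l set \<Rightarrow> 'k) set" where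
  "regular_places L \<iota> U =
     {h. \<exists>z \<in> carrier L. \<forall>R \<in> U. z \<in> R \<and> z \<ominus>\<^bsub>L\<^esub> \<iota> (h R) \<in> place_ideal L R}"

definition nonsingular_curve ::
  "('l, 'm) ring_scheme \<Rightarrow> ('k \<Rightarrow> 'l) \<Rightarrow> ('l set, 'k) curve" where
  "nonsingular_curve L \<iota> = \<lparr>zariski = zariski_places L \<iota>, regular = regular_places L \<iota>\<rparr>"

subsection \<open>Artin--Schreier curves\<close>

definition AS_admissible :: "nat \<Rightarrow> 'k::field poly fract \<Rightarrow> bool" where
  "AS_admissible p f \<longleftrightarrow> \<not> (\<exists>z. f = z ^ p - z)"

definition AS_poly :: "nat \<Rightarrow> 'k::field poly fract \<Rightarrow> 'k poly fract poly" where
  "AS_poly p f = [:0, 1:] ^ p - [:0, 1:] - [:f:]"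

text \<open>
  The function field \<open>k(x)[y] / (y\<^sup>p - y - f)\<close>; residue classes are represented by the
  polynomials in \<open>y\<close> of degree less than \<open>p\<close>.
\<close>
definition AS_function_field ::
  "nat \<Rightarrow> 'k::field poly fract \<Rightarrow> 'k poly fract poly ring" where
  "AS_function_field p f =
     \<lparr>carrier = {u. Polynomial.degree u < p}, monoid.mult = (\<lambda>u v. (u * v) mod AS_poly p f), one = 1,
      zero = 0, add = (+)\<rparr>"

definition AS_curve ::
  "nat \<Rightarrow> 'k::field poly fract \<Rightarrow> ('k poly fract poly set, 'k) curve" where
  "AS_curve p f = nonsingular_curve (AS_function_field p f) (\<lambda>c. [:rat_const c:])"

subsection \<open>Standard form\<close>

definition no_exponent_divisible :: "nat \<Rightarrow> 'k::zero poly \<Rightarrow> bool" where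
  "no_exponent_divisible p F \<longleftrightarrow> (\<forall>n. Polynomial.coeff F n \<noteq> 0 \<longrightarrow> \<not> p dvd n)"

text \<open>\<open>x\<^sup>d g(1/x)\<close>, for \<open>deg g \<le> d\<close>\<close>
definition reversed_poly :: "nat \<Rightarrow> 'k::comm_ring_1 poly \<Rightarrow> 'k poly" where
  "reversed_poly d g = monom 1 (d - Polynomial.degree g) * reflect_poly g"

definition standard_form_1 :: "nat \<Rightarrow> (nat \<Rightarrow> nat) \<Rightarrow> 'k::field poly fract \<Rightarrow> bool" where
  "standard_form_1 p d g \<longleftrightarrow>
     (\<exists>Q. g = rat_X ^ d 1 + to_fract Q \<and> [:0, 1:]\<^sup>2 dvd Q \<and> no_exponent_divisible p Q)"

definition standard_form_2 :: "nat \<Rightarrow> (nat \<Rightarrow> nat) \<Rightarrow> 'k::field poly fract \<Rightarrow> bool" where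
  "standard_form_2 p d g \<longleftrightarrow>
     (\<exists>F G. g = to_fract F + rat_subst G (1 / rat_X) \<and>
        lead_coeff F = 1 \<and> Polynomial.degree F = d 1 \<and> Polynomial.degree G = d 2 \<and>
        no_exponent_divisible p F \<and> no_exponent_divisible p G)"

definition standard_form_3 ::
  "nat \<Rightarrow> nat \<Rightarrow> (nat \<Rightarrow> nat) \<Rightarrow> 'k::field poly fract \<Rightarrow> bool" where
  "standard_form_3 p r d g \<longleftrightarrow>
     (\<exists>F G H S.
        g = to_fract F + rat_subst G (1 / rat_X) + rat_subst H (1 / (rat_X - 1)) + S \<and>
        Polynomial.degree F = d 1 \<and> Polynomial.degree G = d 2 \<and> Polynomial.degree H = d 3 \<and>
        no_exponent_divisible p F \<and> no_exponent_divisible p G \<and> no_exponent_divisible p H \<and>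
        (S = 0 \<or>
         (\<exists>l q. S = (\<Sum>i = 4..r + 1.
                       rat_subst (q i) (rat_X - rat_const (l i)) /
                         (rat_X - rat_const (l i)) ^ d i) \<and>
            (\<forall>i \<in> {4..r + 1}. l i \<notin> {0, 1} \<and> q i \<noteq> 0 \<and> Polynomial.degree (q i) < d i \<and>
               no_exponent_divisible p (reversed_poly (d i) (q i))))))"

definition standard_form ::
  "nat \<Rightarrow> nat \<Rightarrow> (nat \<Rightarrow> nat) \<Rightarrow> 'k::field poly fract \<Rightarrow> bool" where
  "standard_form p r d g \<longleftrightarrow>
     (r = 0 \<longrightarrow> standard_form_1 p d g) \<and>
     (r = 1 \<longrightarrow> standard_form_2 p d g) \<and>
     (r \<ge> 2 \<longrightarrow> standard_form_3 p r d g)"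

end

theory Submission
  imports Defs
begin

text \<open>
  By partial fractions, \<open>f\<close> is a constant plus a sum of terms \<open>\<Gamma>\<^sub>P(u\<^sub>P)\<close> over its poles \<open>P\<close>, where
  \<open>u\<^sub>a = 1 / (x - a)\<close>, \<open>u\<^sub>\<infinity> = x\<close> and \<open>deg \<Gamma>\<^sub>P\<close> is the pole order. A Moebius automorphism \<open>\<mu>\<close> of
  \<open>k(x)\<close> sends each \<open>u\<^sub>P\<close> to an affine function of \<open>u\<^sub>Q\<close>, \<open>Q\<close> being the image of \<open>P\<close>, so it moves
  up to three poles to \<open>\<infinity>, 0, 1\<close> and preserves the shape and the degrees. Since \<open>k\<close> is perfect,
  monomials \<open>a t\<^bsup>p m\<^esup>\<close> can be replaced by \<open>a\<^bsup>1/p\<^esup> t\<^sup>m\<close> modulo \<open>z\<^sup>p - z\<close>, separately in each \<open>\<Gamma>\<^sub>P\<close>.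
  If there is a single pole, translations of \<open>x\<close> remain available, and the linear coefficient of the
  reduction of \<open>f(x + c)\<close>, up to a power of Frobenius, is a nonconstant polynomial in \<open>c\<close>, so some \<open>c\<close>
  kills it.
  Both moves, \<open>f \<mapsto> \<mu> f\<close> and \<open>f \<mapsto> f + z\<^sup>p - z\<close>, extend to isomorphisms of the function fields and
  hence of the curves.
\<close>

subsection \<open>Curves of isomorphic function fields\<close>

lemma topspace_zariski_places: "topspace (zariski_places L \<iota>) = places L \<iota>"
  unfolding topspace_def openin_zariski_places
  by (intro equalityI Union_least Union_upper) simp_all

lemma ring_iso_inv:
  assumes "field L" "field L'" "h \<in> ring_iso L L'" "z \<in> carrier L" "z \<noteq> \<zero>\<^bsub>L\<^esub>"
  shows "h (inv\<^bsub>L\<^esub> z) = inv\<^bsub>L'\<^esub> (h z)"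
proof -
  interpret L: field L by fact
  interpret L': field L' by fact
  have z: "z \<in> Units L" using assms L.field_Units by auto
  have "h z \<otimes>\<^bsub>L'\<^esub> h (inv\<^bsub>L\<^esub> z) = \<one>\<^bsub>L'\<^esub>"
    using ring_iso_memE(2)[OF assms(3), of z "inv\<^bsub>L\<^esub> z"] ring_iso_memE(4)[OF assms(3)]
      L.Units_inv_closed[OF z] L.Units_r_inv[OF z] assms(4) by simp
  then show ?thesis
    using ring_iso_memE(1)[OF assms(3)] L.Units_inv_closed[OF z] assms(4)
    by (intro L'.comm_inv_char[symmetric]) auto
qed

lemma ring_iso_minus:
  assumes "field L" "field L'" "h \<in> ring_iso L L'" "z \<in> carrier L" "w \<in> carrier L"
  shows "h (z \<ominus>\<^bsub>L\<^esub> w) = h z \<ominus>\<^bsub>L'\<^esub> h w"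
proof -
  interpret L: field L by fact
  interpret L': field L' by fact
  interpret ring_hom_ring L L' h
    using assms(3) by unfold_locales (auto simp: ring_iso_def)
  show ?thesis using assms by (simp add: a_minus_def)
qed

lemma ring_iso_zero:
  assumes "field L" "field L'" "h \<in> ring_iso L L'"
  shows "h \<zero>\<^bsub>L\<^esub> = \<zero>\<^bsub>L'\<^esub>"
proof -
  interpret L: field L by fact
  interpret L': field L' by fact
  interpret ring_hom_ring L L' h
    using assms(3) by unfold_locales (auto simp: ring_iso_def)
  show ?thesis by simp
qed

lemma ring_iso_image_places:
  assumes "field L" "field L'" and h: "h \<in> ring_iso L L'"
    and \<iota>: "\<And>c. \<iota> c \<in> carrier L" "\<And>c. \<iota>' c = h (\<iota> c)" and R: "R \<in> places L \<iota>"
  shows "h ` R \<in> places L' \<iota>'"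
proof -
  interpret L: field L by fact
  interpret L': field L' by fact
  interpret ring_hom_ring L L' h
    using h by unfold_locales (auto simp: ring_iso_def)
  have R: "subring R L" "range \<iota> \<subseteq> R" "R \<noteq> carrier L"
    "\<And>z. z \<in> carrier L \<Longrightarrow> z \<noteq> \<zero>\<^bsub>L\<^esub> \<Longrightarrow> z \<in> R \<or> inv\<^bsub>L\<^esub> z \<in> R"
    using R by (auto simp: places_def)
  note RL = subringE(1)[OF R(1)]
  have bij: "bij_betw h (carrier L) (carrier L')" using h by (simp add: ring_iso_def)
  have "h ` R \<noteq> carrier L'"
    using inj_on_image_eq_iff[of h "carrier L" R "carrier L"] bij R(3) RL by (simp add: bij_betw_def)
  moreover have "w \<in> h ` R \<or> inv\<^bsub>L'\<^esub> w \<in> h ` R" if w: "w \<in> carrier L'" "w \<noteq> \<zero>\<^bsub>L'\<^esub>" for w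
  proof -
    obtain z where z: "z \<in> carrier L" "w = h z" using bij w by (auto simp: bij_betw_def)
    have "z \<noteq> \<zero>\<^bsub>L\<^esub>" using w z by auto
    then show ?thesis
      using R(4)[of z] z ring_iso_inv[OF assms(1,2) h, of z, symmetric] by auto
  qed
  ultimately show ?thesis
    using R(2) img_is_subring[OF R(1)] \<iota>(2) by (auto simp: places_def)
qed

text \<open>Taking images under \<open>h\<close> transports all the data of the curve: valuation
  rings, their maximal ideals (described through inverses alone) and residue values, the last
  because \<open>h\<close> matches the two embeddings of the constants.\<close>

lemma curve_isomorphic_nonsingular_curve:
  assumes F: "field L" "field L'" and h: "h \<in> ring_iso L L'"
    and \<iota>: "\<And>c. \<iota> c \<in> carrier L" "\<And>c. \<iota>' c = h (\<iota> c)"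
  shows "curve_isomorphic (nonsingular_curve L \<iota>) (nonsingular_curve L' \<iota>')"
proof -
  interpret L: field L by fact
  interpret L': field L' by fact
  define \<phi> where "\<phi> = (`) h"
  have bij: "bij_betw h (carrier L) (carrier L')" using h by (simp add: ring_iso_def)
  then have inj: "inj_on h (carrier L)" by (simp add: bij_betw_def)
  define g where "g = inv_into (carrier L) h"
  have g: "g \<in> ring_iso L' L"
    unfolding g_def by (rule ring_iso_set_sym[OF L.ring_axioms h])
  have gh: "g (h z) = z" if "z \<in> carrier L" for z
    using that inj by (simp add: g_def)
  have hg: "h (g z) = z" if "z \<in> carrier L'" for z
    using that bij by (simp add: g_def f_inv_into_f bij_betw_def)
  have \<iota>': "\<iota>' c \<in> carrier L'" "\<iota> c = g (\<iota>' c)" for c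
    using \<iota> ring_iso_memE(1)[OF h] gh by auto
  have sub: "R \<subseteq> carrier L" if "R \<in> places L \<iota>" for R
    using that subringE(1)[of R L] by (auto simp: places_def)
  have sub': "R \<subseteq> carrier L'" if "R \<in> places L' \<iota>'" for R
    using that subringE(1)[of R L'] by (auto simp: places_def)
  have \<phi>: "bij_betw \<phi> (places L \<iota>) (places L' \<iota>')"
  proof (rule bij_betw_byWitness[where f' = "(`) g"])
    show "\<forall>R\<in>places L \<iota>. g ` \<phi> R = R"
    proof
      fix R assume "R \<in> places L \<iota>"
      then have "g (h z) = z" if "z \<in> R" for z
        using sub gh that by (meson subsetD)
      then show "g ` \<phi> R = R" by (simp add: \<phi>_def image_image)
    qed
    show "\<forall>R\<in>places L' \<iota>'. \<phi> (g ` R) = R"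
    proof
      fix R assume "R \<in> places L' \<iota>'"
      then have "h (g z) = z" if "z \<in> R" for z
        using sub' hg that by (meson subsetD)
      then show "\<phi> (g ` R) = R" by (simp add: \<phi>_def image_image)
    qed
    show "\<phi> ` places L \<iota> \<subseteq> places L' \<iota>'"
      using ring_iso_image_places[OF F h \<iota>] by (auto simp: \<phi>_def)
    show "(`) g ` places L' \<iota>' \<subseteq> places L \<iota>"
      using ring_iso_image_places[OF F(2,1) g \<iota>'] by auto
  qed
  have mem: "h z \<in> \<phi> R \<longleftrightarrow> z \<in> R" if "R \<in> places L \<iota>" "z \<in> carrier L" for R z
    using that sub inj by (auto simp: \<phi>_def inj_on_image_mem_iff)
  have ideal: "h z \<in> place_ideal L' (\<phi> R) \<longleftrightarrow> z \<in> place_ideal L R"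
    if R: "R \<in> places L \<iota>" and z: "z \<in> carrier L" for R z
  proof (cases "z = \<zero>\<^bsub>L\<^esub>")
    case True
    then show ?thesis using mem[OF R z] ring_iso_zero[OF F h] by (auto simp: place_ideal_def)
  next
    case False
    then have "h z \<noteq> \<zero>\<^bsub>L'\<^esub>"
      using inj_on_eq_iff[OF inj z L.zero_closed] ring_iso_zero[OF F h] by simp
    moreover have "inv\<^bsub>L\<^esub> z \<in> carrier L"
      using False z L.field_Units by simp
    ultimately show ?thesis
      using mem[OF R z] mem[OF R, of "inv\<^bsub>L\<^esub> z"] ring_iso_inv[OF F h z False] False
      by (auto simp: place_ideal_def)
  qed
  have reg: "u \<in> regular_places L' \<iota>' V \<longleftrightarrow>
      u \<circ> \<phi> \<in> regular_places L \<iota> {R \<in> places L \<iota>. \<phi> R \<in> V}"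
    (is "?l = ?r") if V: "V \<subseteq> places L' \<iota>'" for V u
  proof -
    have carr: "carrier L' = h ` carrier L"
      using bij by (simp add: bij_betw_def)
    \<comment> \<open>Every place in \<open>V\<close> is the image of a place of \<open>L\<close>,
      so quantification over \<open>V\<close> can be pulled back along
      \<open>\<phi>\<close>.\<close>
    have VE: "(\<forall>R\<in>V. A R) \<longleftrightarrow> (\<forall>R\<in>{R \<in> places L \<iota>. \<phi> R \<in> V}. A (\<phi> R))" for A
    proof -
      have "R \<in> \<phi> ` places L \<iota>" if "R \<in> V" for R
        using \<phi> V that by (auto simp: bij_betw_def)
      then show ?thesis by blast
    qed
    have "?l \<longleftrightarrow> (\<exists>z\<in>carrier L. \<forall>R\<in>V. h z \<in> R \<and> h z \<ominus>\<^bsub>L'\<^esub> \<iota>' (u R) \<in> place_ideal L' R)"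
      unfolding regular_places_def carr by simp
    also have "\<dots> \<longleftrightarrow> (\<exists>z\<in>carrier L. \<forall>R\<in>{R \<in> places L \<iota>. \<phi> R \<in> V}.
        h z \<in> \<phi> R \<and> h z \<ominus>\<^bsub>L'\<^esub> \<iota>' (u (\<phi> R)) \<in> place_ideal L' (\<phi> R))"
      by (subst VE) (rule refl)
    also have "\<dots> \<longleftrightarrow> ?r"
      unfolding regular_places_def mem_Collect_eq comp_apply
    proof (intro bex_cong ball_cong refl)
      fix z R assume z: "z \<in> carrier L" and "R \<in> {R \<in> places L \<iota>. \<phi> R \<in> V}"
      then have R: "R \<in> places L \<iota>" by simp
      have "z \<ominus>\<^bsub>L\<^esub> \<iota> (u (\<phi> R)) \<in> carrier L"
        using z \<iota>(1) by (rule L.minus_closed)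
      then show "(h z \<in> \<phi> R \<and> h z \<ominus>\<^bsub>L'\<^esub> \<iota>' (u (\<phi> R)) \<in> place_ideal L' (\<phi> R)) =
          (z \<in> R \<and> z \<ominus>\<^bsub>L\<^esub> \<iota> (u (\<phi> R)) \<in> place_ideal L R)"
        by (simp add: mem[OF R] ideal[OF R] z \<iota> flip: ring_iso_minus[OF F h])
    qed
    finally show ?thesis .
  qed
  \<comment> \<open>Both topologies are cofinite, so a bijection is automatically continuous and
    open.\<close>
  have "homeomorphic_map (zariski_places L \<iota>) (zariski_places L' \<iota>') \<phi>"
  proof (rule bijective_open_imp_homeomorphic_map)
    show "continuous_map (zariski_places L \<iota>) (zariski_places L' \<iota>') \<phi>"
      unfolding continuous_map topspace_zariski_places openin_zariski_places
    proof (intro conjI allI impI)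
      show "\<phi> ` places L \<iota> \<subseteq> places L' \<iota>'" using \<phi> by (auto simp: bij_betw_def)
      fix U assume U: "U \<subseteq> places L' \<iota>' \<and> (U = {} \<or> finite (places L' \<iota>' - U))"
      have "finite (places L \<iota> - {x \<in> places L \<iota>. \<phi> x \<in> U})" if "finite (places L' \<iota>' - U)"
        by (rule inj_on_finite[OF _ _ that, of \<phi>]) (use \<phi> in \<open>auto simp: bij_betw_def inj_on_def\<close>)
      then show "{x \<in> places L \<iota>. \<phi> x \<in> U} = {} \<or> finite (places L \<iota> - {x \<in> places L \<iota>. \<phi> x \<in> U})"
        using U by auto
    qed auto
    show "open_map (zariski_places L \<iota>) (zariski_places L' \<iota>') \<phi>"
      unfolding open_map_def openin_zariski_places
    proof (intro allI impI conjI)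
      fix U assume U: "U \<subseteq> places L \<iota> \<and> (U = {} \<or> finite (places L \<iota> - U))"
      then show "\<phi> ` U \<subseteq> places L' \<iota>'" using \<phi> by (auto simp: bij_betw_def)
      have "places L' \<iota>' - \<phi> ` U \<subseteq> \<phi> ` (places L \<iota> - U)"
        using \<phi> unfolding bij_betw_def by blast
      then show "\<phi> ` U = {} \<or> finite (places L' \<iota>' - \<phi> ` U)"
        using U by (auto intro: finite_subset)
    qed
    show "\<phi> ` topspace (zariski_places L \<iota>) = topspace (zariski_places L' \<iota>')"
      unfolding topspace_zariski_places using \<phi> by (simp add: bij_betw_def)
    show "inj_on \<phi> (topspace (zariski_places L \<iota>))"
      unfolding topspace_zariski_places using \<phi> by (simp add: bij_betw_def)
  qed
  then show ?thesis
    unfolding curve_isomorphic_def nonsingular_curve_def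
    using reg by (intro exI[of _ \<phi>]) (simp add: openin_zariski_places topspace_zariski_places)
qed

subsection \<open>Artin--Schreier function fields\<close>

text \<open>A nonzero element of least degree in the ideal generated by \<open>u\<close> and
  \<open>A\<close> divides both generators, by division with remainder. Irreducibility of
  \<open>A\<close> makes it a unit, and multiplying by its inverse gives the coefficients.\<close>

lemma bezout_irreducible_poly:
  fixes A u :: "'a::field poly"
  assumes A: "Factorial_Ring.irreducible A" and u: "\<not> A dvd u"
  shows "\<exists>a b. a * u + b * A = 1"
proof -
  define I where "I = {g. g \<noteq> 0 \<and> (\<exists>a b. g = a * u + b * A)}"
  have "A \<noteq> 0" using A by auto
  then have "A \<in> I" unfolding I_def by (auto intro: exI[of _ 0] exI[of _ 1])
  then obtain g where g: "g \<in> I" and min: "\<And>h. h \<in> I \<Longrightarrow> Polynomial.degree g \<le> Polynomial.degree h"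
    using arg_min_natI[of "\<lambda>g. g \<in> I" A Polynomial.degree]
      arg_min_nat_le[of "\<lambda>g. g \<in> I" _ Polynomial.degree] by metis
  obtain a b where ab: "g = a * u + b * A" and g0: "g \<noteq> 0" using g by (auto simp: I_def)
  have dvd: "g dvd v" if v: "v = s * u + t * A" for v s t
  proof (rule ccontr)
    assume n: "\<not> g dvd v"
    have "v mod g = v - (v div g) * g" by (simp add: minus_div_mult_eq_mod)
    also have "\<dots> = (s - (v div g) * a) * u + (t - (v div g) * b) * A"
      by (simp add: v ab algebra_simps)
    finally have "v mod g \<in> I" using n by (auto simp: I_def dvd_eq_mod_eq_0)
    then show False using min degree_mod_less_degree[OF g0 n] by fastforce
  qed
  have "g dvd A" using dvd[of A 0 1] by simp
  then obtain k where k: "A = g * k" ..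
  have "g dvd u" using dvd[of u 1 0] by simp
  \<comment> \<open>If \<open>k\<close> were a unit, \<open>A\<close> would divide everything that
    \<open>g\<close> divides, in particular \<open>u\<close>.\<close>
  then have "\<not> k dvd 1" using u mult_unit_dvd_iff[of k g u] by (auto simp only: k)
  then have "g dvd 1" using Factorial_Ring.irreducibleD[OF A k] by blast
  then obtain h where "1 = g * h" ..
  then have "(h * a) * u + (h * b) * A = 1" using ab by (simp add: algebra_simps)
  then show ?thesis by blast
qed

text \<open>Bezout coefficients reduced modulo \<open>A\<close> are the inverses. The record is
  spelled out so that it turns into \<open>AS_function_field\<close> for
  \<open>A = AS_poly p f\<close>.\<close>

lemma field_poly_mod_irreducible:
  fixes A :: "'a::field poly"
  assumes A: "Factorial_Ring.irreducible A"
  shows "field \<lparr>carrier = {u. Polynomial.degree u < Polynomial.degree A},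
    monoid.mult = (\<lambda>u v. (u * v) mod A), one = 1, zero = 0, add = (+)\<rparr>" (is "field ?L")
proof -
  have A0: "A \<noteq> 0" using A by auto
  have deg: "Polynomial.degree A > 0"
    using A A0 by (metis Factorial_Ring.irreducible_def is_unit_iff_degree neq0_conv)
  have small: "u mod A = u" if "Polynomial.degree u < Polynomial.degree A" for u
    using that by (simp add: mod_poly_less)
  have red: "Polynomial.degree (u mod A) < Polynomial.degree A" for u
    using degree_mod_less[OF A0, of u] deg by auto
  have group: "abelian_group ?L"
  proof (rule abelian_groupI)
    fix x assume "x \<in> carrier ?L"
    then show "\<exists>y\<in>carrier ?L. y \<oplus>\<^bsub>?L\<^esub> x = \<zero>\<^bsub>?L\<^esub>"
      by (intro bexI[of _ "- x"]) auto
  qed (use deg in \<open>auto simp: degree_add_less add.assoc add.commute\<close>)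
  have monoid: "comm_monoid ?L"
    by (rule comm_monoidI)
      (use deg in \<open>auto simp: red small mod_mult_left_eq mod_mult_right_eq mult.commute mult.left_commute\<close>)
  have "cring ?L"
    by (rule cringI[OF group monoid]) (simp add: algebra_simps poly_mod_add_left)
  then show ?thesis
  proof (rule cring.cring_fieldI2)
    fix u assume u: "u \<in> carrier ?L" "u \<noteq> \<zero>\<^bsub>?L\<^esub>"
    then have "\<not> A dvd u" using dvd_imp_degree_le[of A u] by auto
    then obtain a b where ab: "a * u + b * A = 1" using bezout_irreducible_poly[OF A] by blast
    have "(u * (a mod A)) mod A = (a * u + b * A) mod A"
      by (simp add: mod_mult_right_eq mult.commute)
    also have "\<dots> = 1" using deg by (simp add: ab small)
    finally show "\<exists>b\<in>carrier ?L. u \<otimes>\<^bsub>?L\<^esub> b = \<one>\<^bsub>?L\<^esub>"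
      using red by (intro bexI[of _ "a mod A"]) auto
  qed auto
qed

section \<open>The polynomial y^p - y - f and its irreducibility\<close>

lemma AS_poly_altdef: "AS_poly p f = monom 1 p + [:- f, - 1:]"
  by (simp add: AS_poly_def monom_altdef)

lemma degree_AS_poly:
  assumes "p > 1"
  shows "Polynomial.degree (AS_poly p f) = p"
  unfolding AS_poly_altdef using assms by (subst degree_add_eq_left) (simp_all add: degree_monom_eq)

lemma CHAR_fract [simp]: "CHAR('a::idom fract) = CHAR('a)"
proof (rule CHAR_eqI)
  have *: "of_nat n = to_fract (of_nat n :: 'a)" for n
    by (induction n) simp_all
  show "of_nat CHAR('a) = (0 :: 'a fract)" by (simp add: *)
  show "CHAR('a) dvd n" if "of_nat n = (0 :: 'a fract)" for n
    using that by (simp add: * of_nat_eq_0_iff_char_dvd)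
qed

text \<open>Frobenius is additive, so the translation y -> y + z only affects the constant term. For
  z in the prime field this is a symmetry of \<open>AS_poly p f\<close>; for general z it is the
  change of variable between two curves.\<close>

lemma AS_poly_pcompose:
  fixes f z :: "'k::field poly fract"
  assumes "prime p" "CHAR('k) = p"
  shows "AS_poly p f \<circ>\<^sub>p [:z, 1:] = AS_poly p (f - (z ^ p - z))"
proof -
  have "[:z, 1:] ^ p = ([:z:] + [:0, 1:]) ^ p" by simp
  also have "\<dots> = [:z:] ^ p + [:0, 1:] ^ p"
    using assms by (intro freshmans_dream) simp_all
  finally show ?thesis
    by (simp add: AS_poly_def pcompose_diff pcompose_hom.hom_power pcompose_pCons poly_const_pow)
qed

text \<open>A factorisation of \<open>q\<close> into nonunits would contain a nonconstant divisor of
  \<open>A\<close> of smaller degree.\<close>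

lemma irreducible_minimal_degree_dvd:
  fixes A q :: "'a::field poly"
  assumes q: "q dvd A" "Polynomial.degree q > 0"
    and min: "\<And>r. r dvd A \<Longrightarrow> Polynomial.degree r > 0 \<Longrightarrow> Polynomial.degree q \<le> Polynomial.degree r"
  shows "Factorial_Ring.irreducible q"
proof (rule Factorial_Ring.irreducibleI)
  show "q \<noteq> 0" using q(2) by auto
  show "\<not> q dvd 1" using q(2) by (auto simp: is_unit_iff_degree)
  fix a b assume ab: "q = a * b"
  then have 0: "a \<noteq> 0" "b \<noteq> 0" using q(2) by auto
  show "a dvd 1 \<or> b dvd 1"
  proof (rule ccontr)
    assume n: "\<not> (a dvd 1 \<or> b dvd 1)"
    then have pos: "Polynomial.degree a > 0" "Polynomial.degree b > 0"
      using 0 by (auto simp: is_unit_iff_degree)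
    have "a dvd A" using ab q(1) by (metis dvd_mult_left)
    then have "Polynomial.degree q \<le> Polynomial.degree a" using min pos by blast
    then show False using pos 0 by (simp add: ab degree_mult_eq)
  qed
qed

text \<open>Different monic irreducible polynomials are nonassociated primes, so each new factor
  must divide the cofactor of the product of the previous ones.\<close>

lemma prod_dvd_of_monic_irreducible:
  fixes q :: "'i \<Rightarrow> 'a::field poly"
  assumes "finite I" "\<And>i. i \<in> I \<Longrightarrow> Factorial_Ring.irreducible (q i)" "\<And>i. i \<in> I \<Longrightarrow> q i dvd A"
    and monic: "\<And>i. i \<in> I \<Longrightarrow> lead_coeff (q i) = 1" and "inj_on q I"
  shows "prod q I dvd A"
  using assms
proof (induction I rule: finite_induct)
  case (insert i I)
  then have "prod q I dvd A" by (auto simp: inj_on_def)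
  then obtain c where c: "A = prod q I * c" ..
  have prime: "Factorial_Ring.prime_elem (q i)"
    using insert.prems(1) by (intro field_poly_irreducible_imp_prime) auto
  have ndvd: "\<not> q i dvd q j" if "j \<in> I" for j
  proof
    assume "q i dvd q j"
    then obtain k where k: "q j = q i * k" ..
    have irr: "Factorial_Ring.irreducible (q i)" "Factorial_Ring.irreducible (q j)"
      using insert.prems(1) that by auto
    then have "k dvd 1" using Factorial_Ring.irreducibleD[OF irr(2) k] by auto
    then obtain a where "k = [:a:]" by (rule is_unit_polyE)
    moreover have "lead_coeff (q i) = 1" "lead_coeff (q j) = 1" using insert.prems(3) that by auto
    ultimately have "q j = q i" using k by (cases "a = 0") auto
    then show False using insert.prems(4) insert.hyps(2) that by (auto simp: inj_on_def)
  qed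
  have "\<not> q i dvd prod q J" if "finite J" "\<And>j. j \<in> J \<Longrightarrow> \<not> q i dvd q j" for J
    using that
  proof (induction J rule: finite_induct)
    case empty
    show ?case using prime_elem_not_unit[OF prime] by (simp only: prod.empty not_False_eq_True)
  qed (auto simp: prime_elem_dvd_mult_iff[OF prime])
  then have "\<not> q i dvd prod q I" using insert.hyps(1) ndvd by blast
  moreover have "q i dvd prod q I * c" using insert.prems(2)[of i] c by simp
  ultimately have "q i dvd c" using prime by (simp add: prime_elem_dvd_mult_iff)
  then show ?case using insert.hyps c by (simp add: mult.commute mult_dvd_mono)
qed simp

text \<open>Fermat's little theorem, by induction from the additivity of Frobenius.\<close>

lemma of_nat_power_CHAR:
  assumes "prime CHAR('a::comm_semiring_1)"
  shows "(of_nat n :: 'a) ^ CHAR('a) = of_nat n"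
  using assms by (induction n) (simp_all add: freshmans_dream prime_gt_0_nat zero_power)

text \<open>By periodicity the value of \<open>q\<close> at 0 recurs at the points
  \<open>of_nat k * c\<close> with \<open>k < CHAR('a)\<close>. These are distinct, so
  \<open>q\<close> minus that value has at least \<open>CHAR('a)\<close> roots.\<close>

lemma degree_ge_card_if_periodic:
  fixes q :: "'a::field poly"
  assumes c: "c \<noteq> 0" and per: "q \<circ>\<^sub>p [:c, 1:] = q" and deg: "Polynomial.degree q > 0"
  shows "CHAR('a) \<le> Polynomial.degree q"
proof -
  have "poly q (of_nat k * c) = poly q 0" for k
  proof (induction k)
    case (Suc k)
    have "poly q (of_nat (Suc k) * c) = poly (q \<circ>\<^sub>p [:c, 1:]) (of_nat k * c)"
      by (simp add: poly_pcompose algebra_simps)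
    then show ?case using Suc per by simp
  qed simp
  then have sub: "(\<lambda>k. of_nat k * c) ` {..<CHAR('a)} \<subseteq> {x. poly (q - [:poly q 0:]) x = 0}"
    by auto
  have "inj_on (\<lambda>k. (of_nat k :: 'a) * c) {..<CHAR('a)}"
    using c by (auto simp: inj_on_def of_nat_eq_iff_cong_CHAR cong_def)
  then have card: "card ((\<lambda>k. (of_nat k :: 'a) * c) ` {..<CHAR('a)}) = CHAR('a)"
    by (simp add: card_image)
  have d: "Polynomial.degree (q - [:poly q 0:]) = Polynomial.degree q"
    unfolding diff_conv_add_uminus using deg by (intro degree_add_eq_left) simp
  then have "q - [:poly q 0:] \<noteq> 0" using deg by auto
  then show ?thesis
    using card_mono[OF poly_roots_finite sub] card_poly_roots_bound[of "q - [:poly q 0:]"] card d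
    by simp
qed

text \<open>Take a monic nonconstant divisor \<open>q\<close> of least degree and its translates by
  the prime field, which are again divisors of least degree. If they are distinct, their product
  divides \<open>AS_poly p f\<close>, which forces \<open>q\<close> to be linear and
  \<open>f\<close> to be of the excluded form. If two coincide, \<open>q\<close> is periodic and has
  full degree. No splitting field is involved.\<close>

lemma irreducible_AS_poly:
  fixes f :: "'k::field poly fract"
  assumes p: "prime p" "CHAR('k) = p" and f: "AS_admissible p f"
  shows "Factorial_Ring.irreducible (AS_poly p f)"
proof -
  define A where "A = AS_poly p f"
  have p1: "p > 1" using p(1) by (rule prime_gt_1_nat)
  have degA: "Polynomial.degree A = p" unfolding A_def by (rule degree_AS_poly[OF p1])
  have A0: "A \<noteq> 0" using degA p1 by auto
  define D where "D = {q. q dvd A \<and> Polynomial.degree q > 0}"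
  have "A \<in> D" using degA p1 by (simp add: D_def)
  then obtain q0 where q0: "q0 \<in> D" and min: "\<And>r. r \<in> D \<Longrightarrow> Polynomial.degree q0 \<le> Polynomial.degree r"
    using arg_min_natI[of "\<lambda>g. g \<in> D" A Polynomial.degree]
      arg_min_nat_le[of "\<lambda>g. g \<in> D" _ Polynomial.degree] by metis
  \<comment> \<open>Making \<open>q\<close> monic ensures that different translates are not
    associates of each other.\<close>
  define q where "q = Polynomial.smult (inverse (lead_coeff q0)) q0"
  have "q0 \<noteq> 0" using q0 by (auto simp: D_def)
  then have q: "lead_coeff q = 1" "q dvd A" "Polynomial.degree q > 0" "Polynomial.degree q = Polynomial.degree q0"
    using q0 by (auto simp: D_def q_def smult_dvd_iff)
  define s where "s i = q \<circ>\<^sub>p [:of_nat i, 1:]" for i :: nat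
  have degs: "Polynomial.degree (s i) = Polynomial.degree q" for i by (simp add: s_def)
  have sdvd: "s i dvd A" for i
  proof -
    have "of_nat i ^ p - (of_nat i :: 'k poly fract) = 0"
      using of_nat_power_CHAR[where 'a="'k poly fract", of i] p by simp
    then have "A \<circ>\<^sub>p [:of_nat i, 1:] = A"
      unfolding A_def by (simp add: AS_poly_pcompose[OF p])
    moreover obtain k where "A = q * k" using q(2) ..
    ultimately show ?thesis
      unfolding s_def by (metis dvd_triv_left pcompose_mult)
  qed
  have irr: "Factorial_Ring.irreducible (s i)" for i
    by (rule irreducible_minimal_degree_dvd[OF sdvd]) (use degs q min in \<open>auto simp: D_def\<close>)
  have lead: "lead_coeff (s i) = 1" for i
    unfolding s_def using q(1) by (subst lead_coeff_comp) simp_all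
  show ?thesis
  proof (cases "inj_on s {..<p}")
    case True
    \<comment> \<open>The product has degree \<open>p\<close> times the degree of \<open>q\<close>,
      which cannot exceed the degree \<open>p\<close> of \<open>A\<close>. So \<open>q\<close> is
      linear, and its root \<open>z\<close> satisfies \<open>f = z ^ p - z\<close>.\<close>
    have "prod s {..<p} dvd A"
      by (rule prod_dvd_of_monic_irreducible) (use True irr sdvd lead in auto)
    then have "Polynomial.degree (prod s {..<p}) \<le> p"
      using dvd_imp_degree_le[OF _ A0] degA by simp
    moreover have "Polynomial.degree (prod s {..<p}) = p * Polynomial.degree q"
      using irr by (subst degree_prod_eq_sum_degree) (auto simp: degs)
    ultimately have "Polynomial.degree q = 1" using q(3) p1 by (cases "Polynomial.degree q") auto
    then obtain a b where ab: "q = [:a, b:]" "b \<noteq> 0" by (rule degree1_coeffs)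
    then have "b = 1" using q(1) by simp
    then have "poly q (- a) = 0" using ab by simp
    then have "poly A (- a) = 0" using q(2) by (metis dvdE mult_zero_left poly_mult)
    then have "f = (- a) ^ p - (- a)" by (simp add: A_def AS_poly_def)
    then show ?thesis using f unfolding AS_admissible_def by blast
  next
    case False
    \<comment> \<open>Undoing the translation by \<open>i\<close> shows that \<open>q\<close> has
      the period \<open>j - i\<close>, which is nonzero in the field since
      \<open>0 < j - i < p\<close>. Then \<open>q\<close> has degree at least \<open>p\<close> and
      its cofactor in \<open>A\<close> is a constant.\<close>
    then obtain i j where ij: "i < j" "j < p" "s i = s j"
      unfolding inj_on_def by (metis lessThan_iff linorder_neqE_nat)
    have "s i \<circ>\<^sub>p [:- of_nat i, 1:] = q"
      by (simp add: s_def pcompose_pCons flip: pcompose_assoc)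
    moreover have "s j \<circ>\<^sub>p [:- of_nat i, 1:] = q \<circ>\<^sub>p [:of_nat (j - i), 1:]"
      using ij by (simp add: s_def of_nat_diff pcompose_pCons flip: pcompose_assoc)
    ultimately have "q \<circ>\<^sub>p [:of_nat (j - i), 1:] = q" using ij by simp
    moreover have "(of_nat (j - i) :: 'k poly fract) \<noteq> 0"
      unfolding of_nat_eq_0_iff_char_dvd using ij p by (auto dest: dvd_imp_le)
    ultimately have "p \<le> Polynomial.degree q"
      using degree_ge_card_if_periodic[of "of_nat (j - i)" q] q p by simp
    moreover obtain k where k: "A = q * k" using q(2) ..
    ultimately have "Polynomial.degree k = 0" "k \<noteq> 0"
      using degA A0 q by (auto simp: degree_mult_eq)
    then have "k dvd 1" by (simp add: is_unit_iff_degree)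
    moreover have "Factorial_Ring.irreducible q" using irr[of 0] by (simp add: s_def)
    ultimately show ?thesis
      by (simp add: k mult.commute[of q] irreducible_mult_unit_left flip: A_def)
  qed
qed

section \<open>Isomorphisms between Artin-Schreier curves\<close>

text \<open>The automorphisms of k(x) over k: a field homomorphism is injective by itself, so
  surjectivity is the only further demand besides fixing the constants.\<close>

definition rat_automorphism :: "('k::field poly fract \<Rightarrow> 'k poly fract) \<Rightarrow> bool" where
  "rat_automorphism \<mu> \<longleftrightarrow> field_hom \<mu> \<and> surj \<mu> \<and> (\<forall>c. \<mu> (rat_const c) = rat_const c)"

text \<open>Apply \<open>\<mu>\<close> to the coefficients and replace y by y - z. This carries the
  polynomial defining one function field to that of the other and keeps degrees in y, so it acts on
  the remainders that represent residue classes.\<close>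

lemma curve_isomorphic_AS_curve:
  fixes f z :: "'k::field poly fract"
  assumes p: "prime p" "CHAR('k) = p" "odd p" and f: "AS_admissible p f" and \<mu>: "rat_automorphism \<mu>"
  defines "g \<equiv> \<mu> f + (z ^ p - z)"
  shows "AS_admissible p g" and "curve_isomorphic (AS_curve p f) (AS_curve p g)"
proof -
  interpret \<mu>: field_hom \<mu> using \<mu> by (simp add: rat_automorphism_def)
  interpret map_\<mu>: map_poly_inj_idom_hom \<mu> ..
  have surj: "surj \<mu>" and const: "\<And>c. \<mu> (rat_const c) = rat_const c"
    using \<mu> by (auto simp: rat_automorphism_def)
  \<comment> \<open>If \<open>g = w ^ p - w\<close>, then \<open>\<mu> f\<close> has the same form
    with \<open>w - z\<close>, and a preimage of \<open>w - z\<close> under \<open>\<mu>\<close>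
    contradicts the admissibility of \<open>f\<close>.\<close>
  show g: "AS_admissible p g"
    unfolding AS_admissible_def
  proof
    assume "\<exists>w. g = w ^ p - w"
    then obtain w where w: "g = w ^ p - w" ..
    have "(w - z + z) ^ p = (w - z) ^ p + z ^ p"
      using p by (intro freshmans_dream) auto
    then have \<mu>f: "\<mu> f = (w - z) ^ p - (w - z)" using w by (simp add: g_def algebra_simps)
    obtain v where v: "w - z = \<mu> v" using surj by (metis surjD)
    have "\<mu> f = \<mu> (v ^ p - v)" using \<mu>f v by (simp add: hom_distribs)
    then have "f = v ^ p - v" by (simp only: \<mu>.eq_iff)
    then show False using f by (auto simp: AS_admissible_def)
  qed
  have p1: "p > 1" using p(1) by (rule prime_gt_1_nat)
  define \<theta> where "\<theta> u = map_poly \<mu> u \<circ>\<^sub>p [:- z, 1:]" for u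
  have deg: "Polynomial.degree (\<theta> u) = Polynomial.degree u" for u by (simp add: \<theta>_def)
  have add: "\<theta> (u + v) = \<theta> u + \<theta> v" for u v
    by (simp add: \<theta>_def hom_distribs pcompose_add)
  have mult: "\<theta> (u * v) = \<theta> u * \<theta> v" for u v
    by (simp add: \<theta>_def hom_distribs pcompose_mult)
  have "map_poly \<mu> (AS_poly p f) = AS_poly p (\<mu> f)"
    by (simp add: AS_poly_altdef hom_distribs)
  \<comment> \<open>Here \<open>p\<close> is odd, so \<open>(- z) ^ p\<close> equals
    \<open>- (z ^ p)\<close>.\<close>
  then have AS: "\<theta> (AS_poly p f) = AS_poly p g"
    using p by (simp add: \<theta>_def AS_poly_pcompose g_def algebra_simps)
  \<comment> \<open>Since \<open>\<theta>\<close> keeps degrees, the image of a remainder is already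
    reduced modulo \<open>AS_poly p g\<close>; the image of the quotient part is a multiple of that
    polynomial.\<close>
  have mod: "\<theta> (u mod AS_poly p f) = \<theta> u mod AS_poly p g" for u
  proof -
    have "Polynomial.degree (u mod AS_poly p f) < p"
      using degree_mod_less[of "AS_poly p f" u] degree_AS_poly[OF p1, of f] p1 by force
    then have "\<theta> (u mod AS_poly p f) = \<theta> (u mod AS_poly p f) mod AS_poly p g"
      by (simp add: mod_poly_less deg degree_AS_poly[OF p1])
    also have "\<dots> = (\<theta> (u div AS_poly p f) * AS_poly p g + \<theta> (u mod AS_poly p f)) mod AS_poly p g"
      by simp
    also have "\<theta> (u div AS_poly p f) * AS_poly p g + \<theta> (u mod AS_poly p f) = \<theta> u"
      by (simp only: div_mult_mod_eq flip: AS mult add)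
    finally show ?thesis .
  qed
  have "inj \<theta>"
  proof (rule injI)
    fix u v assume "\<theta> u = \<theta> v"
    then have "(map_poly \<mu> u - map_poly \<mu> v) \<circ>\<^sub>p [:- z, 1:] = 0"
      by (simp add: \<theta>_def pcompose_diff)
    then have "map_poly \<mu> u - map_poly \<mu> v = 0" by (subst (asm) pcompose_eq_0_iff) auto
    then show "u = v" by simp
  qed
  have surj\<theta>: "\<exists>v. w = \<theta> v" for w
  proof -
    \<comment> \<open>Two uses of \<open>map_poly\<close> merge into one only for a coefficient map
      that sends 0 to 0.\<close>
    have "inv_into UNIV \<mu> 0 = 0" by (rule inv_f_eq) (auto simp: \<mu>.inj_f)
    then have "map_poly \<mu> (map_poly (inv_into UNIV \<mu>) v) = v" for v
      using surj by (simp add: map_poly_map_poly surj_f_inv_f o_def)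
    then have "\<theta> (map_poly (inv_into UNIV \<mu>) (w \<circ>\<^sub>p [:z, 1:])) = w"
      by (simp add: \<theta>_def pcompose_pCons flip: pcompose_assoc)
    then show ?thesis by metis
  qed
  have iso: "\<theta> \<in> ring_iso (AS_function_field p f) (AS_function_field p g)"
  proof (rule ring_iso_memI)
    show "bij_betw \<theta> (carrier (AS_function_field p f)) (carrier (AS_function_field p g))"
      unfolding bij_betw_def
    proof
      show "inj_on \<theta> (carrier (AS_function_field p f))"
        using \<open>inj \<theta>\<close> by (rule inj_on_subset) simp
      show "\<theta> ` carrier (AS_function_field p f) = carrier (AS_function_field p g)"
        using surj\<theta> by (auto simp: AS_function_field_def deg) (metis deg image_eqI mem_Collect_eq)
    qed
  qed (auto simp: AS_function_field_def deg add mult mod, simp add: \<theta>_def hom_distribs)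
  have field: "field (AS_function_field p h)" if "AS_admissible p h" for h :: "'k poly fract"
    using field_poly_mod_irreducible[OF irreducible_AS_poly[OF p(1,2) that]]
    by (simp add: AS_function_field_def degree_AS_poly[OF p1])
  show "curve_isomorphic (AS_curve p f) (AS_curve p g)"
    unfolding AS_curve_def
  proof (rule curve_isomorphic_nonsingular_curve[OF field[OF f] field[OF g] iso])
    show "[:rat_const c:] \<in> carrier (AS_function_field p f)" for c
      using p1 by (simp add: AS_function_field_def)
    show "[:rat_const c:] = \<theta> [:rat_const c:]" for c
      by (simp add: \<theta>_def hom_distribs const)
  qed
qed

subsection \<open>Reduction of polynomials modulo \<open>z\<^sup>p - z\<close>\<close>

text \<open>Makes every constant trivial modulo z^p - z: X^p - X - a has a root.\<close>

lemma ex_AS_root: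
  fixes a :: "'k::alg_closed_field"
  assumes "p > 1"
  shows "\<exists>b. a = b ^ p - b"
proof -
  have "Polynomial.degree (monom 1 p + [:- a, - 1:]) = p"
    using assms by (subst degree_add_eq_left) (simp_all add: degree_monom_eq)
  then obtain b where "poly (monom 1 p + [:- a, - 1:]) b = 0"
    using alg_closed_imp_poly_has_root[of "monom 1 p + [:- a, - 1:]"] assms by auto
  then show ?thesis by (intro exI[of _ b]) (simp add: poly_monom algebra_simps)
qed

text \<open>Strong induction on the degree, peeling off the leading term: a constant is absorbed, a
  term with exponent prime to \<open>p\<close> is kept, and a term a x^(p m) is traded for b x^m
  with b^p = a. Trading only produces lower exponents, so a leading term prime to \<open>p\<close>
  survives unchanged.\<close>

lemma AS_reduction:
  fixes G :: "'k::alg_closed_field poly"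
  assumes p: "prime p" "CHAR('k) = p"
  shows "\<exists>G' Z. G = G' + (Z ^ p - Z) \<and> no_exponent_divisible p G' \<and>
    Polynomial.degree G' \<le> Polynomial.degree G \<and>
    (\<not> p dvd Polynomial.degree G \<longrightarrow> Polynomial.coeff G' (Polynomial.degree G) = lead_coeff G)"
proof (induction "Polynomial.degree G" arbitrary: G rule: less_induct)
  case less
  have p1: "p > 1" using p(1) by (rule prime_gt_1_nat)
  define n where "n = Polynomial.degree G"
  define a where "a = lead_coeff G"
  define R where "R = G - monom a n"
  have G: "G = monom a n + R" by (simp add: R_def)
  show ?case
  proof (cases "n = 0")
    case True
    then have "G = [:a:]" by (metis a_def degree_eq_zeroE lead_coeff_pCons(2) n_def)
    moreover obtain b where "a = b ^ p - b" using ex_AS_root[OF p1] by blast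
    ultimately have "G = 0 + ([:b:] ^ p - [:b:])" by (simp add: poly_const_pow)
    moreover have "no_exponent_divisible p (0 :: 'k poly)" by (simp add: no_exponent_divisible_def)
    ultimately show ?thesis using True by (intro exI[of _ 0] exI[of _ "[:b:]"]) (simp add: n_def)
  next
    case n0: False
    have R: "Polynomial.degree R < n"
      using n0 by (intro degree_lessI) (auto simp: R_def n_def a_def coeff_eq_0)
    show ?thesis
    proof (cases "p dvd n")
      case False
      obtain R' Z where R': "R = R' + (Z ^ p - Z)" "no_exponent_divisible p R'"
        "Polynomial.degree R' \<le> Polynomial.degree R"
        using less[of R] R by (auto simp: n_def)
      have deg: "Polynomial.degree R' < n" using R R' by simp
      have "no_exponent_divisible p (monom a n + R')"
        using R'(2) False by (auto simp: no_exponent_divisible_def)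
      moreover have "Polynomial.degree (monom a n + R') \<le> n"
        using deg by (intro degree_add_le) (auto simp: degree_monom_le)
      moreover have "Polynomial.coeff (monom a n + R') n = a" using deg by (simp add: coeff_eq_0)
      moreover have "G = (monom a n + R') + (Z ^ p - Z)" using G R' by simp
      ultimately show ?thesis by (metis a_def n_def)
    next
      case True
      then obtain m where m: "n = p * m" by blast
      \<comment> \<open>The p-th root exists since k is algebraically closed; the exponent drops
        from \<open>n = p * m\<close> to \<open>m\<close>, so the induction hypothesis
        applies.\<close>
      obtain b where b: "b ^ p = a" using nth_root_exists[of p a] p1 by auto
      have mn: "m < n" using n0 m p1 by simp
      have deg: "Polynomial.degree (monom b m + R) < n"
        using R mn by (intro degree_add_less) (auto intro: le_less_trans[OF degree_monom_le])
      then obtain G' Z where G': "monom b m + R = G' + (Z ^ p - Z)" "no_exponent_divisible p G'"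
        "Polynomial.degree G' \<le> Polynomial.degree (monom b m + R)"
        using less[of "monom b m + R"] unfolding n_def by blast
      have "(Z + monom b m) ^ p = Z ^ p + monom b m ^ p"
        using p by (intro freshmans_dream) auto
      moreover have "monom b m ^ p = monom a n" by (simp add: monom_power b m mult.commute)
      ultimately have "G = G' + ((Z + monom b m) ^ p - (Z + monom b m))"
        using G G'(1) by (simp add: algebra_simps)
      then show ?thesis using G'(2,3) deg True unfolding n_def
        by (intro exI[of _ G'] exI[of _ "Z + monom b m"]) simp
    qed
  qed
qed

section \<open>Removing the linear coefficient by a translation\<close>

lemma coeff_power_CHAR:
  fixes Z :: "'k::comm_ring_1 poly"
  assumes p: "prime p" "CHAR('k) = p"
  shows "Polynomial.coeff (Z ^ p) (p * i) = Polynomial.coeff Z i ^ p"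
    and "\<not> p dvd n \<Longrightarrow> Polynomial.coeff (Z ^ p) n = 0"
proof -
  have p0: "p > 0" using p(1) by (rule prime_gt_0_nat)
  have "Z ^ p = (\<Sum>i\<le>Polynomial.degree Z. monom (Polynomial.coeff Z i) i) ^ p"
    by (simp add: poly_as_sum_of_monoms)
  also have "\<dots> = (\<Sum>i\<le>Polynomial.degree Z. monom (Polynomial.coeff Z i ^ p) (p * i))"
    using p by (subst freshmans_dream_sum) (auto simp: monom_power mult.commute)
  finally have *: "Z ^ p = \<dots>" .
  show "Polynomial.coeff (Z ^ p) (p * i) = Polynomial.coeff Z i ^ p"
    unfolding * using p0 by (auto simp: coeff_sum zero_power coeff_eq_0)
  show "Polynomial.coeff (Z ^ p) n = 0" if "\<not> p dvd n"
    unfolding * using that by (auto simp: coeff_sum intro!: sum.neutral)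
qed

text \<open>
  The sum \<open>\<Sum>\<^sub>j (coeff G p\<^sup>j)\<^bsup>1/p\<^sup>j\<^esup>\<close>, raised to the power \<open>p\<^sup>J\<close> so that no roots occur, is the linear
  coefficient of the reduction of \<open>G\<close>: it is additive and vanishes on \<open>Z\<^sup>p - Z\<close>.
\<close>
definition linear_trace :: "nat \<Rightarrow> nat \<Rightarrow> 'k::comm_ring_1 poly \<Rightarrow> 'k" where
  "linear_trace p J G = (\<Sum>j\<le>J. Polynomial.coeff G (p ^ j) ^ (p ^ (J - j)))"

lemma linear_trace_add:
  fixes G :: "'k::comm_ring_1 poly"
  assumes p: "prime p" "CHAR('k) = p"
  shows "linear_trace p J (G + H) = linear_trace p J G + linear_trace p J H"
  using p by (simp add: linear_trace_def freshmans_dream'[OF _ arg_cong2[where f=power, OF sym refl]] sum.distrib)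

text \<open>The sum telescopes: the coefficient of \<open>Z ^ p\<close> at p^(j+1) is the p-th power
  of that of \<open>Z\<close> at p^j, so the trace of \<open>Z ^ p\<close> is the trace of
  \<open>Z\<close> without its last term, and that term vanishes by assumption.\<close>

lemma linear_trace_AS:
  fixes Z :: "'k::comm_ring_1 poly"
  assumes p: "prime p" "CHAR('k) = p" and Z: "Polynomial.coeff Z (p ^ J) = 0"
  shows "linear_trace p J (Z ^ p - Z) = 0"
proof -
  have p1: "p > 1" using p(1) by (rule prime_gt_1_nat)
  \<comment> \<open>The summand \<open>j = 0\<close> drops out because \<open>p\<close> does not
    divide the exponent \<open>p ^ 0 = 1\<close>; the others are shifted down by one.\<close>
  have "linear_trace p J (Z ^ p) = (\<Sum>j<J. (Polynomial.coeff Z (p ^ j) ^ p) ^ p ^ (J - Suc j))"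
    using p p1 by (simp add: linear_trace_def sum.atMost_shift coeff_power_CHAR zero_power)
  also have "\<dots> = (\<Sum>j<J. Polynomial.coeff Z (p ^ j) ^ p ^ (J - j))"
    by (intro sum.cong refl) (simp flip: power_mult power_Suc add: Suc_diff_Suc)
  also have "\<dots> = linear_trace p J Z"
    using Z by (simp add: linear_trace_def lessThan_Suc_atMost[symmetric])
  finally have "linear_trace p J (Z ^ p - Z + Z) = linear_trace p J Z" by simp
  then have "linear_trace p J (Z ^ p - Z) + linear_trace p J Z = linear_trace p J Z"
    by (simp only: linear_trace_add[OF p])
  then show ?thesis by simp
qed

lemma linear_trace_reduced:
  assumes "prime p" "no_exponent_divisible p G"
  shows "linear_trace p J G = Polynomial.coeff G 1 ^ p ^ J"
proof -
  have p1: "p > 1" using assms(1) by (rule prime_gt_1_nat)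
  have "Polynomial.coeff G (p ^ Suc j) = 0" for j
    using assms(2) dvd_power[of "Suc j" p] unfolding no_exponent_divisible_def by blast
  then show ?thesis using p1 by (simp add: linear_trace_def sum.atMost_shift zero_power)
qed

text \<open>The k-th Hasse derivative of \<open>G\<close>. Binomial coefficients replace division by
  k!, which may be 0 in characteristic p.\<close>

definition taylor_coeff :: "nat \<Rightarrow> 'k::comm_ring_1 poly \<Rightarrow> 'k poly" where
  "taylor_coeff k G =
     (\<Sum>n\<le>Polynomial.degree G. monom (of_nat (n choose k) * Polynomial.coeff G n) (n - k))"

lemma coeff_pcompose_translate:
  "Polynomial.coeff (G \<circ>\<^sub>p [:c, 1:]) k = poly (taylor_coeff k G) c"
proof -
  have "G \<circ>\<^sub>p [:c, 1:] = (\<Sum>n\<le>Polynomial.degree G. monom (Polynomial.coeff G n) n) \<circ>\<^sub>p [:c, 1:]"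
    by (simp add: poly_as_sum_of_monoms)
  also have "\<dots> = (\<Sum>n\<le>Polynomial.degree G. Polynomial.smult (Polynomial.coeff G n) ([:c, 1:] ^ n))"
    by (simp add: pcompose_sum monom_altdef pcompose_smult pcompose_hom.hom_power pcompose_pCons)
  finally have "G \<circ>\<^sub>p [:c, 1:] = \<dots>" .
  moreover have "Polynomial.coeff ([:c, 1:] ^ n) k = of_nat (n choose k) * c ^ (n - k)" for n
    by (cases "k \<le> n")
      (simp_all add: coeff_linear_poly_power coeff_eq_0 degree_linear_power binomial_eq_0)
  ultimately show ?thesis
    by (simp add: taylor_coeff_def coeff_sum poly_sum poly_monom mult_ac)
qed

lemma degree_taylor_coeff_le:
  "Polynomial.degree (taylor_coeff k G) \<le> Polynomial.degree G - k"
  unfolding taylor_coeff_def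
  by (intro degree_sum_le) (auto intro!: order_trans[OF degree_monom_le] diff_le_mono)

text \<open>The leading coefficient of the derivative is \<open>d\<close> times that of
  \<open>G\<close>, and \<open>d\<close> is nonzero in k.\<close>

lemma degree_taylor_coeff_1:
  fixes G :: "'k::idom poly"
  assumes d: "Polynomial.degree G = d" "d \<ge> 2" "\<not> CHAR('k) dvd d"
  shows "Polynomial.degree (taylor_coeff 1 G) = d - 1"
proof -
  have "Polynomial.coeff (taylor_coeff 1 G) (d - 1) =
      (\<Sum>n\<le>d. if n = d then of_nat d * Polynomial.coeff G d else 0)"
    unfolding taylor_coeff_def coeff_sum d(1) using d(2) by (intro sum.cong) auto
  also have "\<dots> \<noteq> 0" using d by (auto simp: of_nat_eq_0_iff_char_dvd)
  finally have "d - 1 \<le> Polynomial.degree (taylor_coeff 1 G)" by (rule le_degree)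
  then show ?thesis using degree_taylor_coeff_le[of 1 G] d by simp
qed

text \<open>The trace of G(x + c) is a polynomial in c. Its summand for \<open>j = 0\<close> comes
  from the first derivative, raised to the highest power of Frobenius, and has strictly larger
  degree than all others; so the polynomial is nonconstant and has a root.\<close>

lemma ex_translate_linear_trace_0:
  fixes G :: "'k::alg_closed_field poly"
  assumes p: "prime p" "CHAR('k) = p"
    and d: "Polynomial.degree G = d" "d \<ge> 2" "\<not> p dvd d"
  shows "\<exists>c. linear_trace p J (G \<circ>\<^sub>p [:c, 1:]) = 0"
proof -
  have p1: "p > 1" using p(1) by (rule prime_gt_1_nat)
  \<comment> \<open>The value of \<open>T\<close> at c is \<open>linear_trace p J\<close> of G(x +
    c).\<close>
  define T where "T = (\<Sum>j\<le>J. taylor_coeff (p ^ j) G ^ (p ^ (J - j)))"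
  \<comment> \<open>The degree of the summand \<open>j = 0\<close>, to which no other summand of
    \<open>T\<close> contributes.\<close>
  define N where "N = (d - 1) * p ^ J"
  have small: "Polynomial.coeff (taylor_coeff (p ^ j) G ^ (p ^ (J - j))) N = 0"
    if j: "j \<in> {..J} - {0}" for j
  proof (rule coeff_eq_0)
    have "Polynomial.degree (taylor_coeff (p ^ j) G ^ (p ^ (J - j)))
        \<le> Polynomial.degree (taylor_coeff (p ^ j) G) * p ^ (J - j)"
      by (rule degree_power_le)
    also have "1 \<le> p ^ j" using p1 by simp
    then have "Polynomial.degree (taylor_coeff (p ^ j) G) \<le> d - 1"
      using degree_taylor_coeff_le[of "p ^ j" G] d by linarith
    then have "Polynomial.degree (taylor_coeff (p ^ j) G) * p ^ (J - j) \<le> (d - 1) * p ^ (J - j)"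
      by (rule mult_right_mono) simp
    also have "\<dots> < N" unfolding N_def
      using d j p1 by (intro mult_strict_left_mono power_strict_increasing) auto
    finally show "Polynomial.degree (taylor_coeff (p ^ j) G ^ (p ^ (J - j))) < N" .
  qed
  have T1: "taylor_coeff 1 G \<noteq> 0" "Polynomial.degree (taylor_coeff 1 G) = d - 1"
    using degree_taylor_coeff_1[OF d(1,2)] d p by auto
  have "Polynomial.coeff T N = Polynomial.coeff (taylor_coeff 1 G ^ (p ^ J)) N"
    unfolding T_def coeff_sum using small by (subst sum.remove[of _ 0]) auto
  also have "\<dots> = lead_coeff (taylor_coeff 1 G) ^ (p ^ J)"
    using T1 lead_coeff_power[of "taylor_coeff 1 G" "p ^ J"]
    by (simp add: degree_power_eq N_def mult.commute)
  also have "\<dots> \<noteq> 0" using T1(1) by (simp only: power_eq_0_iff leading_coeff_0_iff simp_thms)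
  finally have "N \<le> Polynomial.degree T" by (rule le_degree)
  moreover have "N > 0" using d p1 by (simp add: N_def)
  ultimately obtain c where "poly T c = 0" using alg_closed_imp_poly_has_root[of T] by auto
  then show ?thesis
    by (intro exI[of _ c]) (simp add: T_def linear_trace_def coeff_pcompose_translate poly_sum)
qed

lemma degree_AS:
  fixes Z :: "'k::idom poly"
  assumes "p > 1"
  shows "Polynomial.degree (Z ^ p - Z) = p * Polynomial.degree Z"
proof (cases "Polynomial.degree Z = 0")
  case True
  then obtain a where "Z = [:a:]" by (rule degree_eq_zeroE)
  then show ?thesis by (simp add: poly_const_pow)
next
  case False
  then have Z: "Polynomial.degree (Z ^ p) = p * Polynomial.degree Z"
    by (subst degree_power_eq) auto
  have "Polynomial.degree (- Z) < Polynomial.degree (Z ^ p)" using False assms Z by simp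
  then show ?thesis using degree_add_eq_left[of "- Z" "Z ^ p"] Z by simp
qed

text \<open>Choose c so that the trace of the translate vanishes. The trace ignores
  \<open>Z ^ p - Z\<close>, and on the reduced \<open>G'\<close> it is a power of the linear
  coefficient, which is therefore 0.\<close>

lemma ex_translate_AS_reduction:
  fixes G :: "'k::alg_closed_field poly"
  assumes p: "prime p" "CHAR('k) = p"
    and d: "Polynomial.degree G = d" "d \<ge> 2" "\<not> p dvd d"
  shows "\<exists>c G' Z. G \<circ>\<^sub>p [:c, 1:] = G' + (Z ^ p - Z) \<and> no_exponent_divisible p G' \<and>
    Polynomial.coeff G' 1 = 0"
proof -
  have p1: "p > 1" using p(1) by (rule prime_gt_1_nat)
  \<comment> \<open>The level of the trace must be fixed before \<open>Z\<close> is known. Level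
    \<open>d\<close> suffices: comparing degrees below gives degree at most \<open>d\<close> for
    \<open>Z\<close>, and \<open>d < p ^ d\<close>.\<close>
  obtain c where c: "linear_trace p d (G \<circ>\<^sub>p [:c, 1:]) = 0"
    using ex_translate_linear_trace_0[OF p d] by blast
  obtain G' Z where G': "G \<circ>\<^sub>p [:c, 1:] = G' + (Z ^ p - Z)" "no_exponent_divisible p G'"
    "Polynomial.degree G' \<le> Polynomial.degree (G \<circ>\<^sub>p [:c, 1:])"
    using AS_reduction[OF p, of "G \<circ>\<^sub>p [:c, 1:]"] by blast
  have "Z ^ p - Z = G \<circ>\<^sub>p [:c, 1:] - G'" using G'(1) by simp
  then have "p * Polynomial.degree Z \<le> d"
    using degree_AS[OF p1, of Z] degree_diff_le[of "G \<circ>\<^sub>p [:c, 1:]" d G'] G'(3) d by simp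
  then have "Polynomial.degree Z \<le> d" using p1 by (metis One_nat_def le_trans less_or_eq_imp_le mult_le_mono1 nat_mult_1)
  also have "d < p ^ d" using p1 by (intro power_gt_expt) simp
  finally have "linear_trace p d (Z ^ p - Z) = 0"
    using linear_trace_AS[OF p] coeff_eq_0 by blast
  then have "Polynomial.coeff G' 1 ^ p ^ d = 0"
    unfolding linear_trace_reduced[OF p(1) G'(2), symmetric] using c
    by (simp add: G'(1) linear_trace_add[OF p])
  then have "Polynomial.coeff G' 1 = 0" by simp
  then show ?thesis using G'(1,2) by blast
qed

subsection \<open>Substitutions and partial fractions\<close>

interpretation rat_const: field_hom "rat_const :: 'k::field \<Rightarrow> _"
  by unfold_locales (simp_all add: rat_const_def flip: to_fract_add to_fract_mult one_pCons)

interpretation map_rat_const: map_poly_inj_idom_hom "rat_const :: 'k::field \<Rightarrow> _" ..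

lemma rat_subst_add: "rat_subst (F + G) t = rat_subst F t + rat_subst G t"
  by (simp add: rat_subst_def hom_distribs)

lemma rat_subst_diff: "rat_subst (F - G) t = rat_subst F t - rat_subst G t"
  by (simp add: rat_subst_def hom_distribs)

lemma rat_subst_mult: "rat_subst (F * G) t = rat_subst F t * rat_subst G t"
  by (simp add: rat_subst_def hom_distribs)

lemma rat_subst_power: "rat_subst (F ^ n) t = rat_subst F t ^ n"
  by (simp add: rat_subst_def hom_distribs)

lemma rat_subst_0 [simp]: "rat_subst 0 t = 0"
  by (simp add: rat_subst_def)

lemma rat_subst_1 [simp]: "rat_subst 1 t = 1"
  by (simp add: rat_subst_def)

lemma rat_subst_pCons: "rat_subst (pCons c F) t = rat_const c + t * rat_subst F t"
  by (simp add: rat_subst_def hom_distribs)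

lemma rat_subst_monom: "rat_subst (monom c n) t = rat_const c * t ^ n"
  by (simp add: rat_subst_def hom_distribs poly_monom)

lemma rat_subst_pcompose: "rat_subst (F \<circ>\<^sub>p G) t = rat_subst F (rat_subst G t)"
  by (simp add: rat_subst_def hom_distribs poly_pcompose)

lemma rat_subst_linear: "rat_subst (F \<circ>\<^sub>p [:b, a:]) t = rat_subst F (rat_const a * t + rat_const b)"
  by (simp add: rat_subst_pcompose rat_subst_pCons algebra_simps)

lemma rat_subst_X: "rat_subst F rat_X = to_fract F"
proof (induction F)
  case (pCons a F)
  have "to_fract (pCons a F) = to_fract ([:a:] + [:0, 1:] * F)" by simp
  also have "\<dots> = rat_const a + rat_X * to_fract F"
    by (simp only: to_fract_add to_fract_mult rat_const_def rat_X_def)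
  finally show ?case using pCons by (simp add: rat_subst_pCons)
qed simp

lemma to_fract_power: "to_fract (x ^ n) = to_fract x ^ n"
  by (induction n) simp_all

lemma rat_X_minus_const: "rat_X - rat_const a = to_fract [:- a, 1:]"
  by (simp add: rat_X_def rat_const_def flip: to_fract_diff)

lemma rat_X_neq_const: "rat_X - rat_const a \<noteq> 0"
  by (simp add: rat_X_minus_const)

lemma fract_eq_quot_of_fract:
  "f = to_fract (fst (quot_of_fract f)) / to_fract (snd (quot_of_fract f))"
  using quot_to_fract_quot_of_fract[of f]
  by (simp add: quot_to_fract_def case_prod_unfold Fract_conv_to_fract)

lemma rat_fract_cases:
  fixes f :: "'k::field poly fract"
  obtains N D where "D \<noteq> 0" "f = to_fract N / to_fract D"
  using that by (cases f) (auto simp: Fract_conv_to_fract)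

section \<open>Homomorphisms and automorphisms of the rational function field\<close>

text \<open>Over an algebraically closed field a nonconstant \<open>t\<close> is transcendental:
  each root a of \<open>F\<close> splits off a factor t - a, which is nonzero, and the cofactor has
  smaller degree.\<close>

lemma rat_subst_eq_0_iff:
  fixes F :: "'k::alg_closed_field poly"
  assumes t: "\<And>c. t \<noteq> rat_const c"
  shows "rat_subst F t = 0 \<longleftrightarrow> F = 0"
proof (induction "Polynomial.degree F" arbitrary: F)
  case 0
  then obtain a where "F = [:a:]" by (metis degree_eq_zeroE)
  then show ?case by (simp add: rat_subst_pCons)
next
  case (Suc n)
  then obtain a where "poly F a = 0" using alg_closed_imp_poly_has_root[of F] by auto
  then obtain K where K: "F = [:- a, 1:] * K" by (auto simp: poly_eq_0_iff_dvd)
  moreover have "K \<noteq> 0" using Suc.hyps(2) K by auto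
  ultimately have "Polynomial.degree K = n"
    using Suc.hyps(2) degree_mult_eq[of "[:- a, 1:]" K] by (simp del: mult_pCons_left)
  then have "rat_subst K t \<noteq> 0" using Suc.hyps(1)[of K] \<open>K \<noteq> 0\<close> by simp
  then show ?case
    using t[of a] \<open>K \<noteq> 0\<close> 
    by (simp add: K rat_subst_mult rat_subst_pCons hom_distribs add_eq_0_iff del: mult_pCons_left)
qed

text \<open>The universal property of k(x): since \<open>t\<close> is transcendental, substituting
  it keeps denominators nonzero.\<close>

lemma ex_rat_hom:
  fixes t :: "'k::{alg_closed_field,field_gcd} poly fract"
  assumes t: "\<And>c. t \<noteq> rat_const c"
  shows "\<exists>\<mu>. field_hom \<mu> \<and> (\<forall>F. \<mu> (to_fract F) = rat_subst F t)"
proof -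
  \<comment> \<open>Defined on the reduced fraction. Cross-multiplication then shows independence of
    the representative, as sums and products of reduced fractions need not come out reduced.\<close>
  define \<mu> where "\<mu> f = rat_subst (fst (quot_of_fract f)) t / rat_subst (snd (quot_of_fract f)) t" for f
  have \<mu>: "\<mu> (to_fract a / to_fract b) = rat_subst a t / rat_subst b t" if b: "b \<noteq> 0" for a b
  proof -
    define n where "n = fst (quot_of_fract (to_fract a / to_fract b))"
    define e where "e = snd (quot_of_fract (to_fract a / to_fract b))"
    have e: "e \<noteq> 0" by (simp add: e_def)
    have "to_fract a / to_fract b = to_fract n / to_fract e"
      unfolding n_def e_def by (rule fract_eq_quot_of_fract)
    then have "a * e = n * b" using b e by (simp add: frac_eq_eq flip: to_fract_mult)
    then have "rat_subst a t * rat_subst e t = rat_subst n t * rat_subst b t"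
      by (simp flip: rat_subst_mult)
    then show ?thesis
      using b e by (simp add: \<mu>_def frac_eq_eq rat_subst_eq_0_iff[OF t] flip: n_def e_def)
  qed
  have "field_hom \<mu>"
  proof
    show "\<mu> 0 = 0" using \<mu>[of 1 0] by simp
    show "\<mu> 1 = 1" using \<mu>[of 1 1] by simp
    fix x y :: "'k poly fract"
    obtain a b where x: "b \<noteq> 0" "x = to_fract a / to_fract b" by (rule rat_fract_cases)
    obtain c d where y: "d \<noteq> 0" "y = to_fract c / to_fract d" by (rule rat_fract_cases)
    have xy: "x * y = to_fract (a * c) / to_fract (b * d)"
      "x + y = to_fract (a * d + c * b) / to_fract (b * d)"
      using x y by (simp_all add: add_frac_eq)
    show "\<mu> (x * y) = \<mu> x * \<mu> y"
      unfolding xy using x y by (simp add: \<mu> rat_subst_mult del: to_fract_mult to_fract_add)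
    show "\<mu> (x + y) = \<mu> x + \<mu> y"
      unfolding xy using x y
      by (simp add: \<mu> rat_subst_mult rat_subst_add rat_subst_eq_0_iff[OF t] add_frac_eq
          del: to_fract_mult to_fract_add)
  qed
  moreover have "\<mu> (to_fract F) = rat_subst F t" for F using \<mu>[of 1 F] by simp
  ultimately show ?thesis by blast
qed

lemma rat_hom_subst:
  assumes \<mu>: "field_hom \<mu>" "\<And>c. \<mu> (rat_const c) = rat_const c"
  shows "\<mu> (rat_subst F s) = rat_subst F (\<mu> s)"
proof -
  interpret \<mu>: field_hom \<mu> by fact
  show ?thesis by (induction F) (simp_all add: rat_subst_pCons hom_distribs \<mu>(2))
qed

lemma rat_automorphism_subst:
  "rat_automorphism \<mu> \<Longrightarrow> \<mu> (rat_subst F s) = rat_subst F (\<mu> s)"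
  unfolding rat_automorphism_def by (intro rat_hom_subst) auto

text \<open>The element \<open>s\<close> certifies surjectivity: once it is mapped to x, each N/D is
  the image of N(s)/D(s). The assumption on \<open>s\<close> ranges over all candidates because the
  homomorphism is constructed only inside the proof.\<close>

lemma ex_rat_automorphism:
  fixes t :: "'k::{alg_closed_field,field_gcd} poly fract"
  assumes t: "\<And>c. t \<noteq> rat_const c"
    and inv: "\<And>\<mu>. field_hom \<mu> \<Longrightarrow> \<mu> rat_X = t \<Longrightarrow> (\<And>c. \<mu> (rat_const c) = rat_const c) \<Longrightarrow> \<mu> s = rat_X"
  shows "\<exists>\<mu>. rat_automorphism \<mu> \<and> \<mu> rat_X = t"
proof -
  obtain \<mu> where hom: "field_hom \<mu>" and \<mu>: "\<And>F. \<mu> (to_fract F) = rat_subst F t"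
    using ex_rat_hom[OF t] by blast
  interpret \<mu>: field_hom \<mu> by fact
  have X: "\<mu> rat_X = t" by (simp add: rat_X_def \<mu> rat_subst_pCons)
  have c: "\<mu> (rat_const c) = rat_const c" for c
    by (simp add: rat_const_def \<mu>) (simp add: rat_subst_pCons rat_const_def)
  have s: "\<mu> s = rat_X" by (rule inv[OF hom X c])
  have "\<exists>v. w = \<mu> v" for w
  proof -
    obtain N D where "w = to_fract N / to_fract D" by (rule rat_fract_cases)
    then have "w = \<mu> (rat_subst N s / rat_subst D s)"
      by (simp add: hom_distribs rat_hom_subst[OF hom c] s rat_subst_X)
    then show ?thesis ..
  qed
  then have "rat_automorphism \<mu>" using hom c by (auto simp: rat_automorphism_def surj_def)
  then show ?thesis using X by blast
qed

lemma rat_automorphism_comp: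
  assumes "rat_automorphism \<mu>" "rat_automorphism \<nu>"
  shows "rat_automorphism (\<mu> \<circ> \<nu>)"
proof -
  interpret \<mu>: field_hom \<mu> using assms by (simp add: rat_automorphism_def)
  interpret \<nu>: field_hom \<nu> using assms by (simp add: rat_automorphism_def)
  have "field_hom (\<mu> \<circ> \<nu>)" by unfold_locales (simp_all add: hom_distribs)
  moreover have "surj (\<mu> \<circ> \<nu>)"
    using assms by (intro comp_surj) (simp_all add: rat_automorphism_def)
  ultimately show ?thesis using assms by (simp add: rat_automorphism_def)
qed

lemma rat_automorphism_id: "rat_automorphism (id :: 'k::field poly fract \<Rightarrow> _)"
proof -
  have "field_hom (id :: 'k poly fract \<Rightarrow> _)" by unfold_locales simp_all
  then show ?thesis by (simp add: rat_automorphism_def)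
qed

section \<open>Partial fraction decomposition\<close>

text \<open>Induction on the degree of \<open>D\<close>: at a root b of order m, a term c/(x - b)^m
  is split off, which lowers the order of the denominator by one. \<open>N\<close> and
  \<open>D\<close> may share roots, so the degree of \<open>G a\<close> is exact only where
  \<open>N\<close> does not vanish. Allowing every finite \<open>A\<close> that contains the roots
  lets the same \<open>A\<close> serve for both denominators, although b may cease to be a
  root.\<close>

lemma partial_fractions:
  fixes N D :: "'k::alg_closed_field poly"
  assumes "D \<noteq> 0"
  shows "\<exists>F G. Polynomial.degree F = Polynomial.degree N - Polynomial.degree D \<and>
    (\<forall>a. Polynomial.degree (G a) \<le> Polynomial.order a D \<and>
       (poly N a \<noteq> 0 \<longrightarrow> Polynomial.degree (G a) = Polynomial.order a D)) \<and>
    (\<forall>A. finite A \<longrightarrow> {a. poly D a = 0} \<subseteq> A \<longrightarrow>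
       to_fract N / to_fract D = to_fract F + (\<Sum>a\<in>A. rat_subst (G a) (1 / (rat_X - rat_const a))))"
  using assms
proof (induction "Polynomial.degree D" arbitrary: N D)
  case 0
  then obtain e where e: "D = [:e:]" "e \<noteq> 0" by (metis degree_eq_zeroE pCons_0_0)
  have "order a D = 0" for a using e by (intro order_0I) simp
  moreover have "to_fract N / to_fract D = to_fract (Polynomial.smult (inverse e) N)"
  proof -
    have "N = Polynomial.smult (inverse e) N * D" using e by simp
    then have "to_fract N = to_fract (Polynomial.smult (inverse e) N) * to_fract D"
      by (metis to_fract_mult)
    then show ?thesis using 0 by (simp add: field_simps)
  qed
  ultimately show ?case using e
    by (intro exI[of _ "Polynomial.smult (inverse e) N"] exI[of _ "\<lambda>_. 0"]) simp
next
  case (Suc n)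
  then obtain b where b: "poly D b = 0" using alg_closed_imp_poly_has_root[of D] by auto
  define m where "m = Polynomial.order b D"
  obtain E where E: "D = [:- b, 1:] ^ m * E" "\<not> [:- b, 1:] dvd E"
    using order_decomp[OF Suc.prems, of b] by (auto simp: m_def)
  have m0: "m > 0" using b Suc.prems by (simp add: m_def order_gt_0_iff)
  then obtain k where k: "m = Suc k" by (cases m) auto
  have Eb: "poly E b \<noteq> 0" using E(2) by (simp add: poly_eq_0_iff_dvd)
  have E0: "E \<noteq> 0" using Eb by auto
  define D' where "D' = [:- b, 1:] ^ k * E"
  have D: "D = [:- b, 1:] * D'" by (simp only: E(1) D'_def k power_Suc mult.assoc)
  have D'0: "D' \<noteq> 0" using D Suc.prems by auto
  have degD: "Polynomial.degree D = Suc (Polynomial.degree D')"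
    using degree_mult_eq[of "[:- b, 1:]" D'] D'0 by (simp add: D del: mult_pCons_left)
  have n: "n = Polynomial.degree D'" using Suc.hyps(2) degD by simp
  \<comment> \<open>With this value \<open>N - c E\<close> vanishes at b, so one factor x - b
    cancels against \<open>D\<close>.\<close>
  define c where "c = poly N b / poly E b"
  have "poly (N - Polynomial.smult c E) b = 0" using Eb by (simp add: c_def)
  then obtain N' where N': "N - Polynomial.smult c E = [:- b, 1:] * N'"
    by (metis poly_eq_0_iff_dvd dvdE)
  obtain F G where deg: "Polynomial.degree F = Polynomial.degree N' - Polynomial.degree D'"
    and G: "\<And>a. Polynomial.degree (G a) \<le> Polynomial.order a D'"
      "\<And>a. poly N' a \<noteq> 0 \<Longrightarrow> Polynomial.degree (G a) = Polynomial.order a D'"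
    and sum: "\<And>A. finite A \<Longrightarrow> {a. poly D' a = 0} \<subseteq> A \<Longrightarrow>
       to_fract N' / to_fract D' = to_fract F + (\<Sum>a\<in>A. rat_subst (G a) (1 / (rat_X - rat_const a)))"
    using Suc.hyps(1)[OF n D'0, of N'] by (elim exE conjE, intro that) blast+
  have order_D: "Polynomial.order a D = Polynomial.order a [:- b, 1:] + Polynomial.order a D'" for a
    unfolding D using D'0 by (intro order_mult) (simp del: mult_pCons_left)
  have order_b: "Polynomial.order b D' = k"
    using order_D[of b] order_power_n_n[of b 1] by (simp add: k flip: m_def)
  have order_a: "Polynomial.order a D = Polynomial.order a D'" if "a \<noteq> b" for a
    using order_D[of a] order_0I[of "[:- b, 1:]" a] that by simp
  \<comment> \<open>The variable of \<open>G b\<close> stands for 1/(x - b). As \<open>G b\<close>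
    has degree at most \<open>k < m\<close>, the new monomial is the leading one whenever
    \<open>c\<close> is nonzero.\<close>
  define G' where "G' = G(b := monom c m + G b)"
  have degE: "Polynomial.degree E \<le> Polynomial.degree D'"
    using E0 by (simp add: D'_def degree_mult_eq)
  have "Polynomial.degree F = Polynomial.degree N - Polynomial.degree D"
  proof (cases "Polynomial.degree N > Polynomial.degree D")
    case True
    have "Polynomial.degree (- Polynomial.smult c E) < Polynomial.degree N"
      using degE degD True degree_smult_le[of c E] by simp
    then have "Polynomial.degree (N - Polynomial.smult c E) = Polynomial.degree N"
      unfolding diff_conv_add_uminus by (rule degree_add_eq_left)
    then have "Polynomial.degree ([:- b, 1:] * N') = Polynomial.degree N" by (simp only: N')
    moreover from this have "N' \<noteq> 0" using True by auto
    ultimately have "Polynomial.degree N = Suc (Polynomial.degree N')"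
      by (subst (asm) degree_mult_eq) auto
    then show ?thesis using deg degD by simp
  next
    case False
    have "Polynomial.degree ([:- b, 1:] * N') \<le> Polynomial.degree D"
      unfolding N'[symmetric] using False degE degD degree_smult_le[of c E]
      by (intro degree_diff_le) auto
    \<comment> \<open>Either way both truncated differences of degrees are 0; for
      \<open>N' = 0\<close> because the zero polynomial has degree 0.\<close>
    then have "N' = 0 \<or> Polynomial.degree N' \<le> Polynomial.degree D'"
      using degD by (cases "N' = 0") (simp_all add: degree_mult_eq del: mult_pCons_left)
    then show ?thesis using deg False by auto
  qed
  moreover have "Polynomial.degree (G' a) \<le> Polynomial.order a D \<and>
       (poly N a \<noteq> 0 \<longrightarrow> Polynomial.degree (G' a) = Polynomial.order a D)" for a
  proof (cases "a = b")
    case True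
    have lt: "Polynomial.degree (G b) < m" using G(1)[of b] order_b k by simp
    have "Polynomial.degree (monom c m + G b) \<le> m"
      using lt by (intro degree_add_le degree_monom_le) simp
    moreover have "Polynomial.degree (monom c m + G b) = m" if "poly N b \<noteq> 0"
    proof -
      have "c \<noteq> 0" using that Eb by (simp add: c_def)
      then show ?thesis using lt by (subst degree_add_eq_left) (simp_all add: degree_monom_eq)
    qed
    ultimately show ?thesis using True by (simp add: G'_def m_def)
  next
    case False
    have "Polynomial.degree (G a) = Polynomial.order a D'" if Na: "poly N a \<noteq> 0"
    proof (cases "poly D' a = 0")
      case True
      \<comment> \<open>At a root a of \<open>D'\<close> other than b, \<open>E\<close> vanishes, so
        \<open>N\<close> at a is (a - b) times \<open>N'\<close> at a and the exactness of the
        degree is inherited.\<close>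
      then have "poly E a = 0" using False by (simp add: D'_def)
      moreover have "poly (N - Polynomial.smult c E) a = (a - b) * poly N' a" 
        by (simp only: N') (simp add: left_diff_distrib)
      ultimately have "poly N' a \<noteq> 0" using Na by auto
      then show ?thesis by (rule G(2))
    next
      case False
      then show ?thesis using G(1)[of a] order_0I[of D' a] by simp
    qed
    then show ?thesis using False G(1)[of a] by (simp add: G'_def order_a)
  qed
  moreover have "to_fract N / to_fract D =
      to_fract F + (\<Sum>a\<in>A. rat_subst (G' a) (1 / (rat_X - rat_const a)))"
    if A: "finite A" "{a. poly D a = 0} \<subseteq> A" for A
  proof -
    have bA: "b \<in> A" using b A by auto
    define x where "x = rat_X - rat_const b"
    have x: "x = to_fract [:- b, 1:]" by (simp add: x_def rat_X_minus_const)
    have x0: "x \<noteq> 0" by (simp add: x)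
    have fD': "to_fract D' = x ^ k * to_fract E" "to_fract E \<noteq> 0" "to_fract D' \<noteq> 0"
      by (simp only: D'_def to_fract_mult to_fract_power x) (simp_all add: E0 D'0)
    have fD: "to_fract D = x * to_fract D'" by (simp only: D to_fract_mult x)
    have smult: "to_fract (Polynomial.smult c E) = rat_const c * to_fract E"
      by (simp add: rat_const_def flip: to_fract_mult)
    have "to_fract (N - Polynomial.smult c E) = to_fract ([:- b, 1:] * N')" by (simp only: N')
    then have "to_fract N = rat_const c * to_fract E + x * to_fract N'"
      by (simp only: to_fract_diff to_fract_mult smult x diff_eq_eq add.commute)
    then have "to_fract N / to_fract D = rat_const c / x ^ m + to_fract N' / to_fract D'"
      using x0 fD'(2,3) unfolding fD by (simp add: k field_simps) (simp add: fD'(1) field_simps)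
    also have "to_fract N' / to_fract D' =
        to_fract F + (\<Sum>a\<in>A. rat_subst (G a) (1 / (rat_X - rat_const a)))"
      by (rule sum[OF A(1)]) (use A(2) D in auto)
    also have "(\<Sum>a\<in>A. rat_subst (G a) (1 / (rat_X - rat_const a))) =
        rat_subst (G b) (1 / x) + (\<Sum>a\<in>A - {b}. rat_subst (G a) (1 / (rat_X - rat_const a)))"
      using A(1) bA by (simp add: sum.remove x_def)
    also have "rat_const c / x ^ m + (to_fract F + (rat_subst (G b) (1 / x) +
        (\<Sum>a\<in>A - {b}. rat_subst (G a) (1 / (rat_X - rat_const a))))) =
        to_fract F + (rat_subst (G' b) (1 / x) +
        (\<Sum>a\<in>A - {b}. rat_subst (G' a) (1 / (rat_X - rat_const a))))"
      by (simp add: G'_def rat_subst_add rat_subst_monom power_one_over)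
    also have "rat_subst (G' b) (1 / x) +
        (\<Sum>a\<in>A - {b}. rat_subst (G' a) (1 / (rat_X - rat_const a))) =
        (\<Sum>a\<in>A. rat_subst (G' a) (1 / (rat_X - rat_const a)))"
      using A(1) bA by (simp add: sum.remove x_def)
    finally show ?thesis .
  qed
  ultimately show ?case by blast
qed

subsection \<open>Poles under Moebius transformations\<close>

text \<open>A generator of k(x) whose only pole is a simple pole at the given point.\<close>

fun pole_fun :: "'k::field proj_line \<Rightarrow> 'k poly fract" where
  "pole_fun (Affine a) = 1 / (rat_X - rat_const a)"
| "pole_fun Infinity = rat_X"

text \<open>Partial fractions of the reduced representation: coprimality makes the numerator nonzero
  at the roots of the denominator, so the degrees are exactly the pole orders.\<close>

lemma pole_expansion:
  fixes f :: "'k::{alg_closed_field,field_gcd} poly fract"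
  shows "finite (poles f) \<and> (\<exists>c \<Gamma>. f = rat_const c + (\<Sum>P\<in>poles f. rat_subst (\<Gamma> P) (pole_fun P)) \<and>
    (\<forall>P\<in>poles f. Polynomial.degree (\<Gamma> P) = pole_order f P))"
proof -
  define N D where "N = fst (quot_of_fract f)" and "D = snd (quot_of_fract f)"
  have D0: "D \<noteq> 0" by (simp add: D_def)
  have f: "f = to_fract N / to_fract D" unfolding N_def D_def by (rule fract_eq_quot_of_fract)
  define A where "A = {a. poly D a = 0}"
  have A: "finite A" unfolding A_def by (rule poly_roots_finite[OF D0])
  have NA: "poly N a \<noteq> 0" if "a \<in> A" for a
  proof
    assume "poly N a = 0"
    then have "[:- a, 1:] dvd N" "[:- a, 1:] dvd D" using that by (auto simp: A_def poly_eq_0_iff_dvd)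
    moreover have "coprime N D" unfolding N_def D_def by (rule coprime_quot_of_fract)
    ultimately have "[:- a, 1:] dvd 1" by (rule coprime_common_divisor[rotated])
    then show False by (simp add: is_unit_iff_degree)
  qed
  obtain F G where degF: "Polynomial.degree F = Polynomial.degree N - Polynomial.degree D"
    and G: "\<And>a. poly N a \<noteq> 0 \<Longrightarrow> Polynomial.degree (G a) = Polynomial.order a D"
    and "\<And>A. finite A \<Longrightarrow> {a. poly D a = 0} \<subseteq> A \<Longrightarrow>
       to_fract N / to_fract D = to_fract F + (\<Sum>a\<in>A. rat_subst (G a) (1 / (rat_X - rat_const a)))"
    using partial_fractions[OF D0, of N] by (elim exE conjE, intro that) blast+
  then have sum: "f = to_fract F + (\<Sum>a\<in>A. rat_subst (G a) (1 / (rat_X - rat_const a)))"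
    using A unfolding f A_def by blast
  define \<Gamma> where "\<Gamma> = case_proj_line G F"
  define B where "B = (if Polynomial.degree N > Polynomial.degree D then {Infinity :: 'k proj_line} else {})"
  have "P \<in> poles f \<longleftrightarrow> P \<in> Affine ` A \<union> B" for P
    using D0 by (cases P) (auto simp: poles_def A_def B_def order_gt_0_iff simp flip: N_def D_def)
  then have poles: "poles f = Affine ` A \<union> B" by blast
  \<comment> \<open>Without a pole at infinity the polynomial part is a constant and becomes the
    separate summand; otherwise it belongs, with its constant term, to the pole at infinity.\<close>
  have "f = rat_const (if B = {} then Polynomial.coeff F 0 else 0) + (\<Sum>P\<in>poles f. rat_subst (\<Gamma> P) (pole_fun P))"
  proof -
    have "(\<Sum>P\<in>poles f. rat_subst (\<Gamma> P) (pole_fun P)) =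
        (\<Sum>P\<in>Affine ` A. rat_subst (\<Gamma> P) (pole_fun P)) + (\<Sum>P\<in>B. rat_subst (\<Gamma> P) (pole_fun P))"
      unfolding poles using A by (intro sum.union_disjoint) (auto simp: B_def)
    also have "(\<Sum>P\<in>Affine ` A. rat_subst (\<Gamma> P) (pole_fun P)) =
        (\<Sum>a\<in>A. rat_subst (G a) (1 / (rat_X - rat_const a)))"
      by (subst sum.reindex) (auto simp: inj_on_def \<Gamma>_def)
    finally have 1: "(\<Sum>P\<in>poles f. rat_subst (\<Gamma> P) (pole_fun P)) =
        (\<Sum>a\<in>A. rat_subst (G a) (1 / (rat_X - rat_const a))) + (\<Sum>P\<in>B. rat_subst (\<Gamma> P) (pole_fun P))" .
    show ?thesis
    proof (cases "B = {}")
      case True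
      then have "Polynomial.degree F = 0" using degF by (simp add: B_def split: if_splits)
      then obtain e where "F = [:e:]" by (rule degree_eq_zeroE)
      then show ?thesis using True by (simp add: 1) (simp add: sum rat_const_def)
    next
      case False
      then have "B = {Infinity}" by (simp add: B_def split: if_splits)
      then show ?thesis by (simp add: 1) (simp add: sum \<Gamma>_def rat_subst_X)
    qed
  qed
  moreover have "\<forall>P\<in>poles f. Polynomial.degree (\<Gamma> P) = pole_order f P"
    unfolding poles using degF G[OF NA] by (auto simp: \<Gamma>_def B_def simp flip: N_def D_def)
  moreover have "finite (poles f)" unfolding poles using A by (simp add: B_def)
  ultimately show ?thesis by blast
qed

section \<open>Moving poles to prescribed points\<close>

text \<open>Records an automorphism with its effect on points. A nonconstant affine relation between
  the pole functions is what keeps the degree of the polynomial attached to each pole.\<close>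

definition moves :: "('k::field poly fract \<Rightarrow> 'k poly fract) \<Rightarrow> ('k proj_line \<Rightarrow> 'k proj_line) \<Rightarrow> bool" where
  "moves \<mu> \<pi> \<longleftrightarrow> rat_automorphism \<mu> \<and> inj \<pi> \<and>
     (\<forall>P. \<exists>\<alpha> \<beta>. \<alpha> \<noteq> 0 \<and> \<mu> (pole_fun P) = rat_const \<alpha> * pole_fun (\<pi> P) + rat_const \<beta>)"

lemma moves_id: "moves (id :: 'k::field poly fract \<Rightarrow> _) id"
proof -
  have "\<exists>\<alpha> \<beta>. \<alpha> \<noteq> 0 \<and> id (pole_fun P) = rat_const \<alpha> * pole_fun (id P) + rat_const \<beta>"
    for P :: "'k proj_line"
    by (intro exI[of _ 1] exI[of _ 0]) simp
  then show ?thesis unfolding moves_def using rat_automorphism_id inj_on_id by blast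
qed

lemma moves_comp:
  assumes "moves \<mu> \<pi>" "moves \<nu> \<rho>"
  shows "moves (\<nu> \<circ> \<mu>) (\<rho> \<circ> \<pi>)"
proof -
  have aut: "rat_automorphism \<mu>" "rat_automorphism \<nu>" using assms by (auto simp: moves_def)
  interpret \<nu>: field_hom \<nu> using aut by (simp add: rat_automorphism_def)
  have "\<exists>\<alpha> \<beta>. \<alpha> \<noteq> 0 \<and> \<nu> (\<mu> (pole_fun P)) = rat_const \<alpha> * pole_fun (\<rho> (\<pi> P)) + rat_const \<beta>" for P
  proof -
    obtain a b where 1: "a \<noteq> 0" "\<mu> (pole_fun P) = rat_const a * pole_fun (\<pi> P) + rat_const b"
      using assms(1) unfolding moves_def by blast
    obtain c e where 2: "c \<noteq> 0" "\<nu> (pole_fun (\<pi> P)) = rat_const c * pole_fun (\<rho> (\<pi> P)) + rat_const e"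
      using assms(2) unfolding moves_def by blast
    have "\<nu> (\<mu> (pole_fun P)) = rat_const (a * c) * pole_fun (\<rho> (\<pi> P)) + rat_const (a * e + b)"
      using aut(2) by (simp add: 1 2 hom_distribs rat_automorphism_def algebra_simps)
    then show ?thesis using 1 2 by (intro exI[of _ "a * c"] exI[of _ "a * e + b"]) auto
  qed
  moreover have "inj (\<rho> \<circ> \<pi>)" using assms by (intro inj_compose) (auto simp: moves_def)
  ultimately show ?thesis
    using rat_automorphism_comp[OF aut(2,1)] by (simp add: moves_def)
qed

text \<open>The direction is contravariant: a x + b - c is a times x - (c - b)/a, so a pole at c
  goes to (c - b)/a.\<close>

lemma ex_moves_affine:
  fixes a b :: "'k::{alg_closed_field,field_gcd}"
  assumes a: "a \<noteq> 0"
  shows "\<exists>\<mu> \<pi>. moves \<mu> \<pi> \<and> \<mu> rat_X = rat_const a * rat_X + rat_const b \<and> \<pi> Infinity = Infinity \<and>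
    (\<forall>c. \<pi> (Affine c) = Affine ((c - b) / a))"
proof -
  have ca: "rat_const a \<noteq> 0" using a by simp
  have "rat_const a * rat_X + rat_const b \<noteq> rat_const c" for c
  proof
    assume "rat_const a * rat_X + rat_const b = rat_const c"
    then have "rat_X - rat_const ((c - b) / a) = 0" using ca by (simp add: hom_distribs field_simps)
    then show False using rat_X_neq_const by blast
  qed
  moreover have "\<mu> ((rat_X - rat_const b) / rat_const a) = rat_X"
    if \<mu>: "field_hom \<mu>" "\<mu> rat_X = rat_const a * rat_X + rat_const b" "\<And>c. \<mu> (rat_const c) = rat_const c" for \<mu>
  proof -
    interpret \<mu>: field_hom \<mu> by fact
    show ?thesis using ca by (simp add: hom_distribs \<mu>(2,3))
  qed
  ultimately obtain \<mu> where \<mu>: "rat_automorphism \<mu>" "\<mu> rat_X = rat_const a * rat_X + rat_const b"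
    using ex_rat_automorphism by metis
  interpret \<mu>: field_hom \<mu> using \<mu>(1) by (simp add: rat_automorphism_def)
  have const: "\<mu> (rat_const c) = rat_const c" for c using \<mu>(1) by (simp add: rat_automorphism_def)
  define \<pi> where "\<pi> = case_proj_line (\<lambda>c. Affine ((c - b) / a)) Infinity"
  have "inj \<pi>"
    using a by (auto simp: inj_on_def \<pi>_def split: proj_line.splits)
  moreover have "\<exists>\<alpha> \<beta>. \<alpha> \<noteq> 0 \<and> \<mu> (pole_fun P) = rat_const \<alpha> * pole_fun (\<pi> P) + rat_const \<beta>" for P
  proof (cases P)
    case (Affine c)
    have "rat_const a * rat_X + rat_const b - rat_const c = rat_const a * (rat_X - rat_const ((c - b) / a))"
      using ca by (simp add: hom_distribs field_simps)
    then have "\<mu> (pole_fun P) = rat_const (1 / a) * pole_fun (\<pi> P) + rat_const 0"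
      by (simp add: Affine \<pi>_def hom_distribs const \<mu>(2))
    then show ?thesis using a by (intro exI[of _ "1 / a"] exI[of _ 0]) simp
  next
    case Infinity
    then show ?thesis using a \<mu>(2) by (intro exI[of _ a] exI[of _ b]) (simp add: \<pi>_def)
  qed
  ultimately have "moves \<mu> \<pi>" using \<mu>(1) by (simp add: moves_def)
  then show ?thesis using \<mu>(2) by (intro exI[of _ \<mu>] exI[of _ \<pi>]) (simp add: \<pi>_def)
qed

text \<open>The substitution x -> 1/x, which exchanges 0 and infinity and is its own inverse. For c
  nonzero, 1/(1/x - c) is affine in 1/(x - 1/c).\<close>

lemma ex_moves_inversion:
  "\<exists>\<mu> \<pi>. moves (\<mu> :: 'k::{alg_closed_field,field_gcd} poly fract \<Rightarrow> _) \<pi> \<and> \<pi> (Affine 0) = Infinity"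
proof -
  have X0: "(rat_X :: 'k poly fract) \<noteq> 0" using rat_X_neq_const[of 0] by simp
  have "1 / rat_X \<noteq> (rat_const c :: 'k poly fract)" for c
  proof
    assume *: "1 / rat_X = rat_const c"
    then have "c \<noteq> 0" using X0 by auto
    then have "rat_X - rat_const (1 / c) = 0" using * X0 by (auto simp add: hom_distribs field_simps)
    then show False using rat_X_neq_const by blast
  qed
  moreover have "\<mu> (1 / rat_X) = rat_X"
    if \<mu>: "field_hom \<mu>" "\<mu> rat_X = 1 / rat_X" for \<mu> :: "'k poly fract \<Rightarrow> _"
  proof -
    interpret \<mu>: field_hom \<mu> by fact
    show ?thesis by (simp add: hom_distribs \<mu>(2))
  qed
  ultimately obtain \<mu> :: "'k poly fract \<Rightarrow> _" where \<mu>: "rat_automorphism \<mu>" "\<mu> rat_X = 1 / rat_X"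
    using ex_rat_automorphism[of "1 / rat_X" "1 / rat_X"] by blast
  interpret \<mu>: field_hom \<mu> using \<mu>(1) by (simp add: rat_automorphism_def)
  have const: "\<mu> (rat_const c) = rat_const c" for c using \<mu>(1) by (simp add: rat_automorphism_def)
  define \<pi> :: "'k proj_line \<Rightarrow> _" where
    "\<pi> = case_proj_line (\<lambda>c. if c = 0 then Infinity else Affine (1 / c)) (Affine 0)"
  have "inj \<pi>"
    by (auto simp: inj_on_def \<pi>_def split: proj_line.splits if_splits)
  moreover have "\<exists>\<alpha> \<beta>. \<alpha> \<noteq> 0 \<and> \<mu> (pole_fun P) = rat_const \<alpha> * pole_fun (\<pi> P) + rat_const \<beta>" for P
  proof (cases P)
    case (Affine c)
    show ?thesis
    proof (cases "c = 0")
      case True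
      then show ?thesis
        by (intro exI[of _ 1] exI[of _ 0]) (simp add: Affine \<pi>_def hom_distribs \<mu>(2))
    next
      case False
      define C where "C = rat_const c"
      have C: "C \<noteq> 0" using False by (simp add: C_def)
      define y where "y = rat_X - rat_const (1 / c)"
      have y: "y \<noteq> 0" unfolding y_def by (rule rat_X_neq_const)
      have X: "rat_X = y + 1 / C" by (simp add: y_def C_def hom_distribs)
      have "1 / rat_X - C = - C * y / rat_X"
        using C X0 unfolding X by (simp add: field_simps)
      then have "1 / (1 / rat_X - C) = - rat_X / (C * y)" by simp
      also have "\<dots> = - (1 / C ^ 2) * (1 / y) + - (1 / C)"
        using C y unfolding X by (simp add: field_simps power2_eq_square)
      finally have "\<mu> (pole_fun P) = rat_const (- (1 / c ^ 2)) * pole_fun (\<pi> P) + rat_const (- (1 / c))"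
        using False by (simp add: Affine \<pi>_def hom_distribs \<mu>(2) const C_def y_def)
      then show ?thesis using False by (intro exI[of _ "- (1 / c ^ 2)"] exI[of _ "- (1 / c)"]) simp
    qed
  next
    case Infinity
    then show ?thesis by (intro exI[of _ 1] exI[of _ 0]) (simp add: \<pi>_def \<mu>(2))
  qed
  ultimately have "moves \<mu> \<pi>" using \<mu>(1) by (simp add: moves_def)
  then show ?thesis by (intro exI[of _ \<mu>] exI[of _ \<pi>]) (simp add: \<pi>_def)
qed

text \<open>Translate a finite point to 0, then invert.\<close>

lemma ex_moves_1:
  fixes P :: "'k::{alg_closed_field,field_gcd} proj_line"
  shows "\<exists>\<mu> \<pi>. moves \<mu> \<pi> \<and> \<pi> P = Infinity"
proof (cases P)
  case (Affine a)
  obtain \<mu> \<pi> where 1: "moves \<mu> \<pi>" "\<pi> (Affine a) = Affine 0"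
    using ex_moves_affine[of 1 a] by auto
  obtain \<nu> \<rho> where 2: "moves \<nu> \<rho>" "\<rho> (Affine (0 :: 'k)) = Infinity"
    using ex_moves_inversion by blast
  show ?thesis using moves_comp[OF 1(1) 2(1)] 1(2) 2(2) Affine
    by (intro exI[of _ "\<nu> \<circ> \<mu>"] exI[of _ "\<rho> \<circ> \<pi>"]) simp
next
  case Infinity
  then show ?thesis using moves_id by (intro exI[of _ id]) simp
qed

text \<open>With the first point at infinity, translations fix it and bring the second point to
  0.\<close>

lemma ex_moves_2:
  fixes P Q :: "'k::{alg_closed_field,field_gcd} proj_line"
  assumes "P \<noteq> Q"
  shows "\<exists>\<mu> \<pi>. moves \<mu> \<pi> \<and> \<pi> P = Infinity \<and> \<pi> Q = Affine 0"
proof -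
  obtain \<mu> \<pi> where 1: "moves \<mu> \<pi>" "\<pi> P = Infinity" using ex_moves_1 by blast
  then have "\<pi> Q \<noteq> Infinity" using assms unfolding moves_def by (metis injD)
  then obtain a where a: "\<pi> Q = Affine a" by (cases "\<pi> Q") auto
  obtain \<nu> \<rho> where 2: "moves \<nu> \<rho>" "\<rho> (Affine a) = Affine 0" "\<rho> Infinity = Infinity"
    using ex_moves_affine[of 1 a] by auto
  show ?thesis using moves_comp[OF 1(1) 2(1)] 1(2) 2(2,3) a
    by (intro exI[of _ "\<nu> \<circ> \<mu>"] exI[of _ "\<rho> \<circ> \<pi>"]) simp
qed

text \<open>With the first two points at infinity and 0, scalings fix both and bring the third point
  to 1.\<close>

lemma ex_moves_3:
  fixes P Q R :: "'k::{alg_closed_field,field_gcd} proj_line"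
  assumes "P \<noteq> Q" "P \<noteq> R" "Q \<noteq> R"
  shows "\<exists>\<mu> \<pi>. moves \<mu> \<pi> \<and> \<pi> P = Infinity \<and> \<pi> Q = Affine 0 \<and> \<pi> R = Affine 1"
proof -
  obtain \<mu> \<pi> where 1: "moves \<mu> \<pi>" "\<pi> P = Infinity" "\<pi> Q = Affine 0"
    using ex_moves_2[OF assms(1)] by blast
  then have "\<pi> R \<noteq> Infinity" "\<pi> R \<noteq> Affine 0"
    using assms unfolding moves_def by (metis injD)+
  then obtain a where a: "\<pi> R = Affine a" "a \<noteq> 0" by (cases "\<pi> R") auto
  obtain \<nu> \<rho> where 2: "moves \<nu> \<rho>" "\<rho> (Affine 0) = Affine 0" "\<rho> (Affine a) = Affine 1"
    "\<rho> Infinity = Infinity"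
    using ex_moves_affine[OF a(2), of 0] a(2) by auto
  show ?thesis using moves_comp[OF 1(1) 2(1)] 1(2,3) 2(2-4) a
    by (intro exI[of _ "\<nu> \<circ> \<mu>"] exI[of _ "\<rho> \<circ> \<pi>"]) simp
qed

subsection \<open>Standard form\<close>

text \<open>The combination of the two moves that \<open>curve_isomorphic_AS_curve\<close> turns
  into an isomorphism of curves.\<close>

definition AS_equiv :: "nat \<Rightarrow> 'k::field poly fract \<Rightarrow> 'k poly fract \<Rightarrow> bool" where
  "AS_equiv p f g \<longleftrightarrow> (\<exists>\<mu> z. rat_automorphism \<mu> \<and> g = \<mu> f + (z ^ p - z))"

lemma AS_equiv_automorphism:
  assumes "p > 0" "rat_automorphism \<mu>"
  shows "AS_equiv p f (\<mu> f)"
  unfolding AS_equiv_def using assms by (intro exI[of _ \<mu>] exI[of _ 0]) (simp add: zero_power)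

lemma AS_equiv_diff:
  assumes "odd p" "f = g + (z ^ p - z)"
  shows "AS_equiv p f g"
  unfolding AS_equiv_def using assms rat_automorphism_id
  by (intro exI[of _ id] exI[of _ "- z"]) (simp add: algebra_simps)

lemma AS_equiv_trans:
  fixes f g h :: "'k::field poly fract"
  assumes p: "prime p" "CHAR('k) = p" and "AS_equiv p f g" "AS_equiv p g h"
  shows "AS_equiv p f h"
proof -
  obtain \<mu> z \<nu> w where \<mu>: "rat_automorphism \<mu>" "g = \<mu> f + (z ^ p - z)"
    and \<nu>: "rat_automorphism \<nu>" "h = \<nu> g + (w ^ p - w)"
    using assms(3,4) by (auto simp: AS_equiv_def)
  interpret \<nu>: field_hom \<nu> using \<nu>(1) by (simp add: rat_automorphism_def)
  have "(\<nu> z + w) ^ p = \<nu> z ^ p + w ^ p" using p by (intro freshmans_dream) auto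
  then have "h = (\<nu> \<circ> \<mu>) f + ((\<nu> z + w) ^ p - (\<nu> z + w))"
    by (simp add: \<nu>(2) \<mu>(2) hom_distribs)
  then show ?thesis
    unfolding AS_equiv_def using rat_automorphism_comp[OF \<nu>(1) \<mu>(1)] by blast
qed

text \<open>Each polynomial is reduced on its own. As Frobenius is additive, the corrections add up,
  together with one for the constant, to a single \<open>z ^ p - z\<close>.\<close>

lemma AS_equiv_sum_reduction:
  fixes t :: "'i \<Rightarrow> 'k::alg_closed_field poly fract"
  assumes p: "prime p" "CHAR('k) = p" "odd p"
  shows "\<exists>\<Gamma>'. AS_equiv p (rat_const c + (\<Sum>i\<in>I. rat_subst (\<Gamma> i) (t i))) (\<Sum>i\<in>I. rat_subst (\<Gamma>' i) (t i)) \<and>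
    (\<forall>i. no_exponent_divisible p (\<Gamma>' i) \<and>
      (\<not> p dvd Polynomial.degree (\<Gamma> i) \<longrightarrow> Polynomial.degree (\<Gamma>' i) = Polynomial.degree (\<Gamma> i)))"
proof -
  have p1: "p > 1" using p(1) by (rule prime_gt_1_nat)
  obtain b where b: "c = b ^ p - b" using ex_AS_root[OF p1] by blast
  have "\<forall>i. \<exists>G' Z. \<Gamma> i = G' + (Z ^ p - Z) \<and> no_exponent_divisible p G' \<and>
    (\<not> p dvd Polynomial.degree (\<Gamma> i) \<longrightarrow> Polynomial.degree G' = Polynomial.degree (\<Gamma> i))"
  proof
    fix i
    obtain G' Z where G': "\<Gamma> i = G' + (Z ^ p - Z)" "no_exponent_divisible p G'"
      "Polynomial.degree G' \<le> Polynomial.degree (\<Gamma> i)"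
      "\<not> p dvd Polynomial.degree (\<Gamma> i) \<Longrightarrow>
        Polynomial.coeff G' (Polynomial.degree (\<Gamma> i)) = lead_coeff (\<Gamma> i)"
      using AS_reduction[OF p(1,2), of "\<Gamma> i"] by blast
    have "Polynomial.degree G' = Polynomial.degree (\<Gamma> i)" if n: "\<not> p dvd Polynomial.degree (\<Gamma> i)"
    proof -
      \<comment> \<open>The zero polynomial has degree 0, which \<open>p\<close> divides. So the
        surviving leading coefficient is nonzero and pins down the degree.\<close>
      have "\<Gamma> i \<noteq> 0" using n by auto
      then have "Polynomial.coeff G' (Polynomial.degree (\<Gamma> i)) \<noteq> 0"
        unfolding G'(4)[OF n] by (simp only: leading_coeff_0_iff simp_thms)
      then show ?thesis using G'(3) le_degree by (intro antisym)
    qed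
    then show "\<exists>G' Z. \<Gamma> i = G' + (Z ^ p - Z) \<and> no_exponent_divisible p G' \<and>
      (\<not> p dvd Polynomial.degree (\<Gamma> i) \<longrightarrow> Polynomial.degree G' = Polynomial.degree (\<Gamma> i))"
      using G'(1,2) by blast
  qed
  then obtain \<Gamma>' Z where \<Gamma>': "\<And>i. \<Gamma> i = \<Gamma>' i + (Z i ^ p - Z i)" "\<And>i. no_exponent_divisible p (\<Gamma>' i)"
    "\<And>i. \<not> p dvd Polynomial.degree (\<Gamma> i) \<Longrightarrow> Polynomial.degree (\<Gamma>' i) = Polynomial.degree (\<Gamma> i)"
    by metis
  define z where "z = rat_const b + (\<Sum>i\<in>I. rat_subst (Z i) (t i))"
  have "z ^ p = rat_const b ^ p + (\<Sum>i\<in>I. rat_subst (Z i) (t i)) ^ p"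
    unfolding z_def using p by (intro freshmans_dream) auto
  also have "(\<Sum>i\<in>I. rat_subst (Z i) (t i)) ^ p = (\<Sum>i\<in>I. rat_subst (Z i) (t i) ^ p)"
    using p by (intro freshmans_dream_sum) auto
  finally have "rat_const c + (\<Sum>i\<in>I. rat_subst (\<Gamma> i) (t i)) =
      (\<Sum>i\<in>I. rat_subst (\<Gamma>' i) (t i)) + (z ^ p - z)"
    by (simp add: z_def \<Gamma>'(1) b hom_distribs rat_subst_add rat_subst_diff rat_subst_power
        sum.distrib sum_subtractf)
  then show ?thesis using AS_equiv_diff[OF p(3)] \<Gamma>'(2,3) by blast
qed

text \<open>Apply \<open>\<mu>\<close> to the expansion of \<open>f\<close> along its poles, absorb
  the affine relations into the polynomials, then reduce them all.\<close>

lemma AS_equiv_reduced_expansion: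
  fixes f :: "'k::{alg_closed_field,field_gcd} poly fract"
  assumes p: "prime p" "CHAR('k) = p" "odd p"
    and P: "bij_betw P I (poles f)" and \<mu>: "moves \<mu> \<pi>"
  shows "\<exists>\<Gamma>. AS_equiv p f (\<Sum>i\<in>I. rat_subst (\<Gamma> i) (pole_fun (\<pi> (P i)))) \<and>
    (\<forall>i\<in>I. no_exponent_divisible p (\<Gamma> i) \<and>
      (\<not> p dvd pole_order f (P i) \<longrightarrow> Polynomial.degree (\<Gamma> i) = pole_order f (P i)))"
proof -
  obtain c \<Gamma> where f: "f = rat_const c + (\<Sum>P\<in>poles f. rat_subst (\<Gamma> P) (pole_fun P))"
    and deg: "\<And>P. P \<in> poles f \<Longrightarrow> Polynomial.degree (\<Gamma> P) = pole_order f P"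
    using pole_expansion[of f] by blast
  have aut: "rat_automorphism \<mu>" using \<mu> by (simp add: moves_def)
  interpret \<mu>: field_hom \<mu> using aut by (simp add: rat_automorphism_def)
  have "\<forall>P. \<exists>\<alpha> \<beta>. \<alpha> \<noteq> 0 \<and> \<mu> (pole_fun P) = rat_const \<alpha> * pole_fun (\<pi> P) + rat_const \<beta>"
    using \<mu> by (simp add: moves_def)
  then obtain \<alpha> \<beta> where \<alpha>: "\<And>P. \<alpha> P \<noteq> 0"
    "\<And>P. \<mu> (pole_fun P) = rat_const (\<alpha> P) * pole_fun (\<pi> P) + rat_const (\<beta> P)"
    by metis
  \<comment> \<open>Composition with a nonconstant linear polynomial rewrites the summand in the
    pole function of the new point, without changing the degree.\<close>
  define \<Delta> where "\<Delta> i = \<Gamma> (P i) \<circ>\<^sub>p [:\<beta> (P i), \<alpha> (P i):]" for i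
  have "\<mu> f = \<mu> (rat_const c) + (\<Sum>P\<in>poles f. rat_subst (\<Gamma> P) (\<mu> (pole_fun P)))"
    by (subst f) (simp add: hom_distribs rat_automorphism_subst[OF aut])
  also have "\<dots> = rat_const c + (\<Sum>i\<in>I. rat_subst (\<Gamma> (P i)) (\<mu> (pole_fun (P i))))"
    using aut sum.reindex_bij_betw[OF P, of "\<lambda>Q. rat_subst (\<Gamma> Q) (\<mu> (pole_fun Q))"]
    by (simp add: rat_automorphism_def)
  also have "\<dots> = rat_const c + (\<Sum>i\<in>I. rat_subst (\<Delta> i) (pole_fun (\<pi> (P i))))"
    by (simp add: \<Delta>_def rat_subst_linear \<alpha>(2))
  finally have "AS_equiv p f \<dots>"
    using AS_equiv_automorphism[OF prime_gt_0_nat[OF p(1)] aut, of f] by simp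
  moreover obtain \<Gamma>' where \<Gamma>': "AS_equiv p (rat_const c + (\<Sum>i\<in>I. rat_subst (\<Delta> i) (pole_fun (\<pi> (P i)))))
      (\<Sum>i\<in>I. rat_subst (\<Gamma>' i) (pole_fun (\<pi> (P i))))" "\<And>i. no_exponent_divisible p (\<Gamma>' i)"
    "\<And>i. \<not> p dvd Polynomial.degree (\<Delta> i) \<Longrightarrow> Polynomial.degree (\<Gamma>' i) = Polynomial.degree (\<Delta> i)"
    using AS_equiv_sum_reduction[OF p, where c = c and I = I and \<Gamma> = \<Delta>
        and t = "\<lambda>i. pole_fun (\<pi> (P i))"] by blast
  ultimately have "AS_equiv p f (\<Sum>i\<in>I. rat_subst (\<Gamma>' i) (pole_fun (\<pi> (P i))))"
    using AS_equiv_trans[OF p(1,2)] by blast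
  moreover have "Polynomial.degree (\<Delta> i) = pole_order f (P i)" if "i \<in> I" for i
    using deg[of "P i"] \<alpha>(1)[of "P i"] P that by (auto simp: \<Delta>_def bij_betw_def)
  ultimately show ?thesis using \<Gamma>'(2,3) by (intro exI[of _ \<Gamma>']) simp
qed

section \<open>Normalisation for one, two and at least three poles\<close>

lemma no_exponent_divisible_scale:
  "no_exponent_divisible p F \<Longrightarrow> no_exponent_divisible p (F \<circ>\<^sub>p [:0, a :: 'k::comm_ring_1:])"
  unfolding no_exponent_divisible_def coeff_pcompose_linear by (metis mult_zero_right)

lemma no_exponent_divisible_coeff_0:
  "no_exponent_divisible p F \<Longrightarrow> Polynomial.coeff F 0 = 0"
  by (auto simp: no_exponent_divisible_def)

lemma X_square_dvd_iff:
  fixes Q :: "'k::idom poly"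
  shows "[:0, 1:]\<^sup>2 dvd Q \<longleftrightarrow> Polynomial.coeff Q 0 = 0 \<and> Polynomial.coeff Q 1 = 0"
proof -
  have X: "[:0, 1:]\<^sup>2 = monom (1 :: 'k) 2" by (simp add: monom_altdef)
  show ?thesis unfolding X monom_1_dvd_iff' by (auto simp: less_2_cases_iff)
qed

text \<open>A linear \<open>G\<close> has no constant term and scales to x. In higher degree a
  translation followed by reduction removes the linear coefficient.\<close>

lemma AS_equiv_standard_form_1:
  fixes G :: "'k::{alg_closed_field,field_gcd} poly"
  assumes p: "prime p" "CHAR('k) = p" "odd p"
    and G: "no_exponent_divisible p G" "Polynomial.degree G = d 1" "\<not> p dvd d 1"
  shows "\<exists>g. AS_equiv p (to_fract G) g \<and> standard_form_1 p d g"
proof (cases "d 1 = 1")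
  case True
  then have "Polynomial.degree G = 1" using G(2) by simp
  then obtain e a where e: "G = [:e, a:]" "a \<noteq> 0" by (rule degree1_coeffs)
  then have a: "G = [:0, a:]" "a \<noteq> 0" using no_exponent_divisible_coeff_0[OF G(1)] by auto
  obtain \<mu> \<pi> where \<mu>: "moves \<mu> \<pi>" "\<mu> rat_X = rat_const (inverse a) * rat_X + rat_const 0"
    using ex_moves_affine[of "inverse a" 0] a(2) by auto
  then have aut: "rat_automorphism \<mu>" by (simp add: moves_def)
  have "\<mu> (to_fract G) = rat_subst G (\<mu> rat_X)"
    using rat_automorphism_subst[OF aut, of G rat_X] by (simp add: rat_subst_X)
  also have "\<dots> = rat_X" using a(2) by (simp add: a(1) rat_subst_pCons \<mu>(2) hom_distribs)
  finally have "AS_equiv p (to_fract G) rat_X"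
    using AS_equiv_automorphism[OF prime_gt_0_nat[OF p(1)] aut, of "to_fract G"] by simp
  moreover have "standard_form_1 p d rat_X"
    unfolding standard_form_1_def using True
    by (intro exI[of _ 0]) (simp add: no_exponent_divisible_def)
  ultimately show ?thesis by blast
next
  case False
  then have d2: "d 1 \<ge> 2" using G(3) by (cases "d 1") auto
  obtain c G' Z where G': "G \<circ>\<^sub>p [:c, 1:] = G' + (Z ^ p - Z)" "no_exponent_divisible p G'"
    "Polynomial.coeff G' 1 = 0"
    using ex_translate_AS_reduction[OF p(1,2) G(2) d2 G(3)] by blast
  obtain \<mu> \<pi> where \<mu>: "moves \<mu> \<pi>" "\<mu> rat_X = rat_const 1 * rat_X + rat_const c"
    using ex_moves_affine[of 1 c] by auto
  then have aut: "rat_automorphism \<mu>" by (simp add: moves_def)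
  have "\<mu> (to_fract G) = rat_subst (G \<circ>\<^sub>p [:c, 1:]) rat_X"
    using rat_automorphism_subst[OF aut, of G rat_X] by (simp only: rat_subst_linear \<mu>(2) rat_subst_X[of G])
  also have "\<dots> = to_fract G' + (to_fract Z ^ p - to_fract Z)"
    by (simp add: G'(1) rat_subst_X to_fract_power)
  finally have "AS_equiv p (\<mu> (to_fract G)) (to_fract G')" by (rule AS_equiv_diff[OF p(3)])
  then have "AS_equiv p (to_fract G) (to_fract G')"
    using AS_equiv_trans[OF p(1,2)] AS_equiv_automorphism[OF prime_gt_0_nat[OF p(1)] aut] by blast
  moreover have "standard_form_1 p d (to_fract G')"
    unfolding standard_form_1_def
  proof (intro exI conjI)
    have "to_fract (monom 1 (d 1)) = (rat_X :: 'k poly fract) ^ d 1"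
      by (simp add: monom_altdef to_fract_power rat_X_def)
    \<comment> \<open>\<open>Q\<close> takes up the difference between \<open>G'\<close> and x^(d
      1), so it may itself contain a multiple of that monomial; the leading coefficient of
      \<open>G'\<close> is not normalised.\<close>
    then show "to_fract G' = rat_X ^ d 1 + to_fract (G' - monom 1 (d 1))" by simp
    show "[:0, 1:]\<^sup>2 dvd G' - monom 1 (d 1)"
      \<comment> \<open>Since \<open>d 1 \<ge> 2\<close>, subtracting the monomial leaves the
        coefficients at 0 and 1 unchanged.\<close>
      unfolding X_square_dvd_iff using G'(3) no_exponent_divisible_coeff_0[OF G'(2)] d2 by simp
    show "no_exponent_divisible p (G' - monom 1 (d 1))"
      using G'(2) G(3) by (auto simp: no_exponent_divisible_def)
  qed
  ultimately show ?thesis by blast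
qed

text \<open>Scalings fix both poles and every exponent; x -> b x with b^(d 1) inverse to the leading
  coefficient of \<open>F\<close> makes \<open>F\<close> monic, while \<open>G\<close> is scaled by
  the inverse of b.\<close>

lemma AS_equiv_standard_form_2:
  fixes F G :: "'k::{alg_closed_field,field_gcd} poly"
  assumes p: "prime p"
    and F: "no_exponent_divisible p F" "Polynomial.degree F = d 1" "\<not> p dvd d 1"
    and G: "no_exponent_divisible p G" "Polynomial.degree G = d 2"
  shows "\<exists>g. AS_equiv p (to_fract F + rat_subst G (1 / rat_X)) g \<and> standard_form_2 p d g"
proof -
  define a where "a = lead_coeff F"
  have d0: "d 1 > 0" using F(3) by (cases "d 1") auto
  then have "F \<noteq> 0" using F(2) by auto
  then have a0: "a \<noteq> 0" by (simp add: a_def)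
  obtain b where b: "b ^ d 1 = inverse a" using nth_root_exists[of "d 1" "inverse a"] d0 by auto
  have b0: "b \<noteq> 0" using a0 b d0 by (auto simp: zero_power)
  obtain \<mu> \<pi> where \<mu>: "moves \<mu> \<pi>" "\<mu> rat_X = rat_const b * rat_X + rat_const 0"
    using ex_moves_affine[OF b0, of 0] by auto
  then have aut: "rat_automorphism \<mu>" by (simp add: moves_def)
  interpret \<mu>: field_hom \<mu> using aut by (simp add: rat_automorphism_def)
  have "\<mu> (to_fract F) = to_fract (F \<circ>\<^sub>p [:0, b:])"
    using rat_automorphism_subst[OF aut, of F rat_X]
    by (simp only: \<mu>(2) rat_subst_X flip: rat_subst_linear)
  moreover have "\<mu> (1 / rat_X) = rat_const (inverse b) * (1 / rat_X) + rat_const 0"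
    by (simp add: hom_distribs \<mu>(2) inverse_eq_divide)
  then have "\<mu> (rat_subst G (1 / rat_X)) = rat_subst (G \<circ>\<^sub>p [:0, inverse b:]) (1 / rat_X)"
    by (simp only: rat_automorphism_subst[OF aut] rat_subst_linear)
  ultimately have "\<mu> (to_fract F + rat_subst G (1 / rat_X)) =
      to_fract (F \<circ>\<^sub>p [:0, b:]) + rat_subst (G \<circ>\<^sub>p [:0, inverse b:]) (1 / rat_X)"
    by (simp add: hom_distribs)
  then have "AS_equiv p (to_fract F + rat_subst G (1 / rat_X))
      (to_fract (F \<circ>\<^sub>p [:0, b:]) + rat_subst (G \<circ>\<^sub>p [:0, inverse b:]) (1 / rat_X))"
    using AS_equiv_automorphism[OF prime_gt_0_nat[OF p] aut] by metis
  moreover have "standard_form_2 p d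
      (to_fract (F \<circ>\<^sub>p [:0, b:]) + rat_subst (G \<circ>\<^sub>p [:0, inverse b:]) (1 / rat_X))"
    unfolding standard_form_2_def
  proof (rule exI[of _ "F \<circ>\<^sub>p [:0, b:]"], rule exI[of _ "G \<circ>\<^sub>p [:0, inverse b:]"], intro conjI)
    show "lead_coeff (F \<circ>\<^sub>p [:0, b:]) = 1"
    proof (subst lead_coeff_comp)
      have "a = Polynomial.coeff F (d 1)" by (simp add: a_def F(2))
      then show "lead_coeff F * lead_coeff [:0, b:] ^ Polynomial.degree F = 1"
        using a0 b0 b F(2) by simp
    qed (use b0 in simp)
  qed (use b0 F G no_exponent_divisible_scale in auto)
  ultimately show ?thesis by blast
qed

text \<open>Translates between H(1/t) and a numerator over t^d. The missing constant term of
  \<open>H\<close> makes the degree of the numerator smaller than \<open>d\<close>;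
  \<open>reversed_poly\<close> restores the power of x that this drop would lose on reflecting
  back.\<close>

lemma reflect_poly_reduced:
  fixes H :: "'k::field poly"
  assumes H: "Polynomial.degree H = d" "d > 0" "Polynomial.coeff H 0 = 0"
  shows "reflect_poly H \<noteq> 0" "Polynomial.degree (reflect_poly H) < d"
    "reversed_poly d (reflect_poly H) = H"
    "t \<noteq> 0 \<Longrightarrow> rat_subst (reflect_poly H) t / t ^ d = rat_subst H (1 / t)"
proof -
  have "H \<noteq> 0" using H by auto
  then show "reflect_poly H \<noteq> 0" by simp
  show lt: "Polynomial.degree (reflect_poly H) < d"
    using H by (intro degree_lessI) (auto simp: coeff_reflect_poly)
  define q where "q = reflect_poly H"
  have q: "Polynomial.coeff q n = (if n > d then 0 else Polynomial.coeff H (d - n))" for n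
    by (simp add: q_def coeff_reflect_poly H)
  have dq: "Polynomial.degree q < d" using lt by (simp add: q_def)
  show "reversed_poly d (reflect_poly H) = H"
    unfolding reversed_poly_def q_def[symmetric]
  proof (rule poly_eqI)
    fix n
    have 1: "Polynomial.coeff H n = 0" if "n > d" using that H by (simp add: coeff_eq_0)
    \<comment> \<open>The low coefficients of \<open>H\<close> are those of \<open>q\<close> above
      its degree.\<close>
    have 2: "Polynomial.coeff H n = 0" if "n < d - Polynomial.degree q"
    proof -
      have "Polynomial.degree q < d - n" "d - (d - n) = n" "\<not> d < d - n" using that by auto
      then show ?thesis using q[of "d - n"] coeff_eq_0[of q "d - n"] by metis
    qed
    show "Polynomial.coeff (monom 1 (d - Polynomial.degree q) * reflect_poly q) n = Polynomial.coeff H n"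
    proof (cases "n < d - Polynomial.degree q")
      case True
      then show ?thesis using 2 by (simp add: coeff_monom_mult)
    next
      case False
      then have "Polynomial.degree q - (n - (d - Polynomial.degree q)) = d - n" using dq by simp
      then show ?thesis
        using False 1 q[of "d - n"] dq by (auto simp: coeff_monom_mult coeff_reflect_poly)
    qed
  qed
  show "rat_subst (reflect_poly H) t / t ^ d = rat_subst H (1 / t)" if "t \<noteq> 0"
  proof -
    have "map_poly rat_const (reflect_poly H) = reflect_poly (map_poly rat_const H)"
      by (rule poly_eqI) (simp add: coeff_reflect_poly coeff_map_poly)
    then show ?thesis
      using that H(1) by (simp add: rat_subst_def poly_reflect_poly_nz inverse_eq_divide)
  qed
qed

text \<open>The summands at infinity, 0 and 1 are F, G and H. By injectivity all other points are
  finite and different from 0 and 1, and their summands are rewritten as fractions with reflected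
  numerators.\<close>

lemma standard_form_3_sum:
  fixes \<Gamma> :: "nat \<Rightarrow> 'k::field poly"
  assumes \<Gamma>: "\<And>i. i \<in> {1..r + 1} \<Longrightarrow> no_exponent_divisible p (\<Gamma> i)"
      "\<And>i. i \<in> {1..r + 1} \<Longrightarrow> Polynomial.degree (\<Gamma> i) = d i"
      "\<And>i. i \<in> {1..r + 1} \<Longrightarrow> \<not> p dvd d i"
    and r: "r \<ge> 2" and Q: "inj_on Q {1..r + 1}" "Q 1 = Infinity" "Q 2 = Affine 0" "Q 3 = Affine 1"
  shows "standard_form_3 p r d (\<Sum>i = 1..r + 1. rat_subst (\<Gamma> i) (pole_fun (Q i)))"
proof -
  have "\<forall>i\<in>{4..r + 1}. \<exists>a. Q i = Affine a \<and> a \<notin> {0, 1}"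
  proof
    fix i assume "i \<in> {4..r + 1}"
    then have "Q i \<noteq> Q 1" "Q i \<noteq> Q 2" "Q i \<noteq> Q 3"
      using r by (auto simp: inj_on_eq_iff[OF Q(1)])
    then show "\<exists>a. Q i = Affine a \<and> a \<notin> {0, 1}" using Q(2-4) by (cases "Q i") auto
  qed
  then obtain l where l: "\<And>i. i \<in> {4..r + 1} \<Longrightarrow> Q i = Affine (l i)"
    "\<And>i. i \<in> {4..r + 1} \<Longrightarrow> l i \<notin> {0, 1}"
    by metis
  define S where "S = (\<Sum>i = 4..r + 1. rat_subst (reflect_poly (\<Gamma> i)) (rat_X - rat_const (l i)) /
                         (rat_X - rat_const (l i)) ^ d i)"
  have rp: "reflect_poly (\<Gamma> i) \<noteq> 0" "Polynomial.degree (reflect_poly (\<Gamma> i)) < d i"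
    "reversed_poly (d i) (reflect_poly (\<Gamma> i)) = \<Gamma> i"
    "t \<noteq> 0 \<Longrightarrow> rat_subst (reflect_poly (\<Gamma> i)) t / t ^ d i = rat_subst (\<Gamma> i) (1 / t)"
    if "i \<in> {1..r + 1}" for i t
  proof -
    have "d i > 0" using \<Gamma>(3)[OF that] by (cases "d i") auto
    note * = reflect_poly_reduced[OF \<Gamma>(2)[OF that] this no_exponent_divisible_coeff_0[OF \<Gamma>(1)[OF that]]]
    show "reflect_poly (\<Gamma> i) \<noteq> 0" "Polynomial.degree (reflect_poly (\<Gamma> i)) < d i"
      "reversed_poly (d i) (reflect_poly (\<Gamma> i)) = \<Gamma> i"
      "t \<noteq> 0 \<Longrightarrow> rat_subst (reflect_poly (\<Gamma> i)) t / t ^ d i = rat_subst (\<Gamma> i) (1 / t)"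
      by (rule *; assumption)+
  qed
  have S: "S = (\<Sum>i = 4..r + 1. rat_subst (\<Gamma> i) (pole_fun (Q i)))"
    unfolding S_def
  proof (rule sum.cong[OF refl])
    fix i assume i: "i \<in> {4..r + 1}"
    then have "i \<in> {1..r + 1}" by simp
    from rp(4)[OF this rat_X_neq_const]
    show "rat_subst (reflect_poly (\<Gamma> i)) (rat_X - rat_const (l i)) / (rat_X - rat_const (l i)) ^ d i =
        rat_subst (\<Gamma> i) (pole_fun (Q i))"
      by (simp add: l(1)[OF i])
  qed
  have split: "{1..r + 1} = insert 1 (insert 2 (insert 3 {4..r + 1}))" using r by auto
  have sum: "(\<Sum>i = 1..r + 1. rat_subst (\<Gamma> i) (pole_fun (Q i))) =
      to_fract (\<Gamma> 1) + rat_subst (\<Gamma> 2) (1 / rat_X) + rat_subst (\<Gamma> 3) (1 / (rat_X - 1)) + S"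
    unfolding split S by (simp add: Q(2)[unfolded One_nat_def] Q(3,4) rat_subst_X add.assoc)
  \<comment> \<open>The second alternative also covers \<open>r = 2\<close>, where the sum is
    empty.\<close>
  have S_form: "S = 0 \<or> (\<exists>l q. S = (\<Sum>i = 4..r + 1. rat_subst (q i) (rat_X - rat_const (l i)) /
                         (rat_X - rat_const (l i)) ^ d i) \<and>
            (\<forall>i \<in> {4..r + 1}. l i \<notin> {0, 1} \<and> q i \<noteq> 0 \<and> Polynomial.degree (q i) < d i \<and>
               no_exponent_divisible p (reversed_poly (d i) (q i))))"
    using l(2) rp(1-3) \<Gamma>(1)
    by (intro disjI2 exI[of _ l] exI[of _ "\<lambda>i. reflect_poly (\<Gamma> i)"]) (simp add: S_def)
  show ?thesis
    unfolding standard_form_3_def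
    by (rule exI[of _ "\<Gamma> 1"], rule exI[of _ "\<Gamma> 2"], rule exI[of _ "\<Gamma> 3"], rule exI[of _ S],
        intro conjI) (rule sum S_form | use \<Gamma>(1,2) r in simp)+
qed

text \<open>Up to three poles are moved to infinity, 0 and 1. The freedom left is then spent as
  follows: with one pole, affine maps adjust the linear coefficient; with two, scalings make
  \<open>F\<close> monic; with three or more, none remains.\<close>

lemma ex_AS_equiv_standard_form:
  fixes f :: "'k::{alg_closed_field,field_gcd} poly fract"
  assumes p: "prime p" "CHAR('k) = p" "odd p"
    and P: "bij_betw P {1..r + 1} (poles f)"
    and d: "\<And>i. i \<in> {1..r + 1} \<Longrightarrow> pole_order f (P i) = d i"
      "\<And>i. i \<in> {1..r + 1} \<Longrightarrow> \<not> p dvd d i"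
  shows "\<exists>g. AS_equiv p f g \<and> standard_form p r d g"
proof -
  have expansion: "\<exists>\<Gamma>. AS_equiv p f (\<Sum>i = 1..r + 1. rat_subst (\<Gamma> i) (pole_fun (\<pi> (P i)))) \<and>
      (\<forall>i\<in>{1..r + 1}. no_exponent_divisible p (\<Gamma> i) \<and> Polynomial.degree (\<Gamma> i) = d i)"
    if "moves \<mu> \<pi>" for \<mu> \<pi>
    using AS_equiv_reduced_expansion[OF p P that] d by metis
  have inj: "P i \<noteq> P j" if "i \<in> {1..r + 1}" "j \<in> {1..r + 1}" "i \<noteq> j" for i j
    using P that by (auto simp: bij_betw_def inj_on_def)
  consider "r = 0" | "r = 1" | "r \<ge> 2" by linarith
  then show ?thesis
  proof cases
    case 1
    obtain \<mu> \<pi> where \<mu>: "moves \<mu> \<pi>" "\<pi> (P 1) = Infinity" using ex_moves_1 by blast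
    obtain \<Gamma> where \<Gamma>: "AS_equiv p f (\<Sum>i = 1..r + 1. rat_subst (\<Gamma> i) (pole_fun (\<pi> (P i))))"
      "\<forall>i\<in>{1..r + 1}. no_exponent_divisible p (\<Gamma> i) \<and> Polynomial.degree (\<Gamma> i) = d i"
      using expansion[OF \<mu>(1)] by blast
    have "AS_equiv p f (to_fract (\<Gamma> 1))" using \<Gamma>(1) 1 \<mu>(2) by (simp add: rat_subst_X)
    moreover obtain g where "AS_equiv p (to_fract (\<Gamma> 1)) g" "standard_form_1 p d g"
      using AS_equiv_standard_form_1[OF p, of "\<Gamma> 1" d] \<Gamma>(2) d(2)[of 1] by auto
    ultimately show ?thesis
      using AS_equiv_trans[OF p(1,2)] 1 by (auto simp: standard_form_def)
  next
    case 2
    have "P 1 \<noteq> P 2" using inj[of 1 2] 2 by simp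
    then obtain \<mu> \<pi> where \<mu>: "moves \<mu> \<pi>" "\<pi> (P 1) = Infinity" "\<pi> (P 2) = Affine 0"
      using ex_moves_2 by blast
    obtain \<Gamma> where \<Gamma>: "AS_equiv p f (\<Sum>i = 1..r + 1. rat_subst (\<Gamma> i) (pole_fun (\<pi> (P i))))"
      "\<forall>i\<in>{1..r + 1}. no_exponent_divisible p (\<Gamma> i) \<and> Polynomial.degree (\<Gamma> i) = d i"
      using expansion[OF \<mu>(1)] by blast
    have "{1..r + 1} = {1, 2}" using 2 by auto
    then have "AS_equiv p f (to_fract (\<Gamma> 1) + rat_subst (\<Gamma> 2) (1 / rat_X))"
      using \<Gamma>(1) \<mu>(2,3) by (simp add: rat_subst_X)
    moreover obtain g where "AS_equiv p (to_fract (\<Gamma> 1) + rat_subst (\<Gamma> 2) (1 / rat_X)) g"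
      "standard_form_2 p d g"
      using AS_equiv_standard_form_2[OF p(1), of "\<Gamma> 1" d "\<Gamma> 2"] \<Gamma>(2) d(2)[of 1] 2 by auto
    ultimately show ?thesis
      using AS_equiv_trans[OF p(1,2)] 2 by (auto simp: standard_form_def)
  next
    case 3
    have "P 1 \<noteq> P 2" "P 1 \<noteq> P 3" "P 2 \<noteq> P 3" using 3 inj[of 1 2] inj[of 1 3] inj[of 2 3] by simp_all
    then obtain \<mu> \<pi> where \<mu>: "moves \<mu> \<pi>" "\<pi> (P 1) = Infinity" "\<pi> (P 2) = Affine 0" "\<pi> (P 3) = Affine 1"
      using ex_moves_3 by blast
    obtain \<Gamma> where \<Gamma>: "AS_equiv p f (\<Sum>i = 1..r + 1. rat_subst (\<Gamma> i) (pole_fun (\<pi> (P i))))"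
      "\<forall>i\<in>{1..r + 1}. no_exponent_divisible p (\<Gamma> i) \<and> Polynomial.degree (\<Gamma> i) = d i"
      using expansion[OF \<mu>(1)] by blast
    have "inj \<pi>" using \<mu>(1) by (simp add: moves_def)
    then have "inj_on (\<lambda>i. \<pi> (P i)) {1..r + 1}"
      using inj by (intro inj_onI) (metis injD)
    then have "standard_form_3 p r d (\<Sum>i = 1..r + 1. rat_subst (\<Gamma> i) (pole_fun (\<pi> (P i))))"
      using \<Gamma>(2) d(2) 3 \<mu>(2-4) by (intro standard_form_3_sum) auto
    then show ?thesis using \<Gamma>(1) 3 by (auto simp: standard_form_def)
  qed
qed

theorem theorem3p3:
  fixes p r :: nat
    and f :: "'p::prime_card mod_ring alg_closure poly fract"
    and P :: "nat \<Rightarrow> 'p mod_ring alg_closure proj_line"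
    and d :: "nat \<Rightarrow> nat"
  assumes "p = CARD('p)" and "odd p"
    and "AS_admissible p f"
    and "bij_betw P {1..r + 1} (poles f)"
    and "\<And>i. i \<in> {1..r + 1} \<Longrightarrow> pole_order f (P i) = d i"
    and "\<And>i j. 1 \<le> i \<Longrightarrow> i \<le> j \<Longrightarrow> j \<le> r + 1 \<Longrightarrow> d j \<le> d i"
    and "\<And>i. i \<in> {1..r + 1} \<Longrightarrow> \<not> p dvd d i"
  shows "\<exists>g :: 'p mod_ring alg_closure poly fract.
           AS_admissible p g \<and> curve_isomorphic (AS_curve p f) (AS_curve p g) \<and>
           standard_form p r d g"
proof -
  have p: "prime p" "CHAR('p mod_ring alg_closure) = p"
    using assms(1) prime_card[where 'a='p] by simp_all
  obtain g where g: "AS_equiv p f g" "standard_form p r d g"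
    using ex_AS_equiv_standard_form[OF p assms(2,4,5,7)] by blast
  \<comment> \<open>This pair is the input from which \<open>curve_isomorphic_AS_curve\<close>
    yields both the admissibility of \<open>g\<close> and the isomorphism.\<close>
  then obtain \<mu> z where "rat_automorphism \<mu>" "g = \<mu> f + (z ^ p - z)"
    by (auto simp: AS_equiv_def)
  then show ?thesis
    using curve_isomorphic_AS_curve[OF p assms(2,3)] g(2) by blast
qed

end
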